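(* If all entries of $\mathbf{A}$ are nonnegative and the deterministic problem $\min\{\mathbf{C}^T\mathbf{x}:\mathbf{x}\in\mathcal{X}\}$ is polynomially solvable, then the problem $$\min\ \mathbf{C}^T\mathbf{x}+\underline{\mathbf{c}}^T\mathbf{y}+\|\mathbf{A}^T\mathbf{y}\|_2\ \ \text{s.t.}\ \ \mathbf{H}(\mathbf{y}+\mathbf{x})\ge\mathbf{g},\ \mathbf{x}+\mathbf{y}\le\mathbf{1},\ \mathbf{x}\in\{0,1\}^n,\ \mathbf{y}\ge\mathbf{0}$$ is approximable within $\sqrt{n}$, i.e. a feasible solution with objective value at most $\sqrt{n}$ times the optimum can be computed in polynomial time.
   Context: Let $\mathcal{X}=\{\mathbf{x}\in\{0,1\}^n:\mathbf{H}\mathbf{x}\ge\mathbf{g}\}$ where the polyhedron $\{\mathbf{x}\in\mathbb{R}^n:\mathbf{H}\mathbf{x}\ge\mathbf{g},\ \mathbf{0}\le\mathbf{x}\le\mathbf{1}\}$ is integral; $\mathbf{C}\in\mathbb{R}^n_{\ge0}$ are first-stage costs. The stated problem is the compact formulation of the robust two-stage problem $\min_{\mathbf{x}}\max_{\mathbf{c}\in\mathcal{U}^{\mathcal{E}}}\min_{\mathbf{y}\in\{0,1\}^n:\mathbf{x}+\mathbf{y}\in\mathcal{X}}(\mathbf{C}^T\mathbf{x}+\mathbf{c}^T\mathbf{y})$ with ellipsoidal uncertainty $\mathcal{U}^{\mathcal{E}}=\{\underline{\mathbf{c}}+\mathbf{A}\boldsymbol{\delta}:\|\boldsymbol{\delta}\|_2\le1\}\subset\mathbb{R}^n_+$,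 $\mathbf{A}\in\mathbb{R}^{n\times n}$. *)

theory Defs
  imports
    "HOL-Analysis.L2_Norm"
    "HOL-Library.Log_Nat"
    "HOL-Computational_Algebra.Polynomial"
    "Jordan_Normal_Form.Matrix"
begin

section \<open>Polynomial-time computation\<close>

text \<open>
  The machine model is a structured random access machine over the integers with the logarithmic
  cost criterion, which is polynomially equivalent to Turing machines. A program works on finitely
  many integer arrays with constant names; the second argument of a state is the array index.
\<close>

type_synonym state = "nat \<Rightarrow> int \<Rightarrow> int"

datatype expr =
    Const int
  | Read nat expr
  | Add expr expr
  | Sub expr expr
  | Mul expr expr
  | Div expr expr

datatype com =
    Skip
  | Store nat expr expr
  | Seq com com
  | IfPos expr com com
  | WhilePos expr com

definition bit_size :: "int \<Rightarrow> nat" where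
  "bit_size k = 1 + floorlog 2 (nat \<bar>k\<bar>)"

fun val :: "state \<Rightarrow> expr \<Rightarrow> int" where
  "val \<sigma> (Const k) = k"
| "val \<sigma> (Read a e) = \<sigma> a (val \<sigma> e)"
| "val \<sigma> (Add e1 e2) = val \<sigma> e1 + val \<sigma> e2"
| "val \<sigma> (Sub e1 e2) = val \<sigma> e1 - val \<sigma> e2"
| "val \<sigma> (Mul e1 e2) = val \<sigma> e1 * val \<sigma> e2"
| "val \<sigma> (Div e1 e2) = val \<sigma> e1 div val \<sigma> e2"

text \<open>
  Every subexpression is charged the bit size of its value; so an operation is charged for its
  operands and its result, and a memory access for the address and the content.
\<close>

fun cost :: "state \<Rightarrow> expr \<Rightarrow> nat" where
  "cost \<sigma> (Const k) = bit_size k"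
| "cost \<sigma> (Read a e) = cost \<sigma> e + bit_size (val \<sigma> (Read a e))"
| "cost \<sigma> (Add e1 e2) = cost \<sigma> e1 + cost \<sigma> e2 + bit_size (val \<sigma> (Add e1 e2))"
| "cost \<sigma> (Sub e1 e2) = cost \<sigma> e1 + cost \<sigma> e2 + bit_size (val \<sigma> (Sub e1 e2))"
| "cost \<sigma> (Mul e1 e2) = cost \<sigma> e1 + cost \<sigma> e2 + bit_size (val \<sigma> (Mul e1 e2))"
| "cost \<sigma> (Div e1 e2) = cost \<sigma> e1 + cost \<sigma> e2 + bit_size (val \<sigma> (Div e1 e2))"

definition store :: "state \<Rightarrow> nat \<Rightarrow> int \<Rightarrow> int \<Rightarrow> state" where
  "store \<sigma> a i v = \<sigma>(a := (\<sigma> a)(i := v))"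

text \<open>\<open>exec p \<sigma> t \<tau>\<close>: started in \<open>\<sigma>\<close>, program \<open>p\<close> halts in \<open>\<tau>\<close> after time \<open>t\<close>.\<close>

inductive exec :: "com \<Rightarrow> state \<Rightarrow> nat \<Rightarrow> state \<Rightarrow> bool" where
  exec_Skip: "exec Skip \<sigma> 1 \<sigma>"
| exec_Store: "exec (Store a e1 e2) \<sigma> (1 + cost \<sigma> e1 + cost \<sigma> e2) (store \<sigma> a (val \<sigma> e1) (val \<sigma> e2))"
| exec_Seq: "exec p \<sigma> s \<tau> \<Longrightarrow> exec q \<tau> t \<upsilon> \<Longrightarrow> exec (Seq p q) \<sigma> (1 + s + t) \<upsilon>"
| exec_IfTrue: "val \<sigma> e > 0 \<Longrightarrow> exec p \<sigma> t \<tau> \<Longrightarrow> exec (IfPos e p q) \<sigma> (1 + cost \<sigma> e + t) \<tau>"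
| exec_IfFalse: "val \<sigma> e \<le> 0 \<Longrightarrow> exec q \<sigma> t \<tau> \<Longrightarrow> exec (IfPos e p q) \<sigma> (1 + cost \<sigma> e + t) \<tau>"
| exec_WhileTrue: "val \<sigma> e > 0 \<Longrightarrow> exec p \<sigma> s \<tau> \<Longrightarrow> exec (WhilePos e p) \<tau> t \<upsilon>
    \<Longrightarrow> exec (WhilePos e p) \<sigma> (1 + cost \<sigma> e + s + t) \<upsilon>"
| exec_WhileFalse: "val \<sigma> e \<le> 0 \<Longrightarrow> exec (WhilePos e p) \<sigma> (1 + cost \<sigma> e) \<sigma>"

text \<open>
  Inputs and outputs are lists of integer lists. The \<open>a\<close>-th list occupies array \<open>a\<close>, with its
  length at index 0 and its entries from index 1 on. Initially all other cells are 0; cells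
  outside the output are ignored at the end.
\<close>

definition init_state :: "int list list \<Rightarrow> state" where
  "init_state xss a i =
     (if a < length xss \<and> 0 \<le> i \<and> i \<le> int (length (xss ! a))
      then (int (length (xss ! a)) # xss ! a) ! nat i else 0)"

definition holds_output :: "state \<Rightarrow> int list list \<Rightarrow> bool" where
  "holds_output \<sigma> xss \<longleftrightarrow>
     (\<forall>a < length xss. \<sigma> a 0 = int (length (xss ! a)) \<and>
        (\<forall>i < length (xss ! a). \<sigma> a (int i + 1) = xss ! a ! i))"

definition input_size :: "int list list \<Rightarrow> nat" where
  "input_size xss = (\<Sum>xs\<leftarrow>xss. 1 + (\<Sum>k\<leftarrow>xs. bit_size k))"

text \<open>
  The search problem with instances \<open>I\<close>, in which an answer \<open>r\<close> with \<open>R i r\<close> has to be found for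
  each \<open>i \<in> I\<close>. One program and one polynomial serve all instances.
\<close>

definition poly_time_search ::
  "'i set \<Rightarrow> ('i \<Rightarrow> int list list) \<Rightarrow> ('i \<Rightarrow> 'r \<Rightarrow> bool) \<Rightarrow> ('r \<Rightarrow> int list list) \<Rightarrow> bool" where
  "poly_time_search I enc_in R enc_out \<longleftrightarrow>
     (\<exists>p (q :: nat poly). \<forall>i \<in> I. \<exists>t \<tau> r.
        exec p (init_state (enc_in i)) t \<tau> \<and> t \<le> poly q (input_size (enc_in i)) \<and>
        holds_output \<tau> (enc_out r) \<and> R i r)"


section \<open>Minimization problems\<close>

text \<open>The answer \<^const>\<open>None\<close> means that the problem is infeasible.\<close>

definition solves :: "'s set \<Rightarrow> ('s \<Rightarrow> real) \<Rightarrow> 's option \<Rightarrow> bool" where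
  "solves F f r \<longleftrightarrow> (case r of
      None \<Rightarrow> F = {}
    | Some s \<Rightarrow> s \<in> F \<and> (\<forall>s' \<in> F. f s \<le> f s'))"

definition solves_within :: "real \<Rightarrow> 's set \<Rightarrow> ('s \<Rightarrow> real) \<Rightarrow> 's option \<Rightarrow> bool" where
  "solves_within \<rho> F f r \<longleftrightarrow> (case r of
      None \<Rightarrow> F = {}
    | Some s \<Rightarrow> s \<in> F \<and> f s \<le> \<rho> * (INF s' \<in> F. f s'))"


section \<open>Encodings of rational data\<close>

definition enc_rats :: "rat list \<Rightarrow> int list list" where
  "enc_rats qs = [map (fst \<circ> quotient_of) qs, map (snd \<circ> quotient_of) qs]"

definition enc_vec :: "rat vec \<Rightarrow> int list list" where
  "enc_vec v = enc_rats (list_of_vec v)"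

definition enc_mat :: "rat mat \<Rightarrow> int list list" where
  "enc_mat A = enc_rats (concat (mat_to_list A))"

definition enc_answer :: "('s \<Rightarrow> int list list) \<Rightarrow> 's option \<Rightarrow> int list list" where
  "enc_answer enc r = (case r of None \<Rightarrow> [[0]] | Some s \<Rightarrow> [1] # enc s)"

abbreviation real_vec :: "rat vec \<Rightarrow> real vec" where
  "real_vec \<equiv> map_vec real_of_rat"

abbreviation real_mat :: "rat mat \<Rightarrow> real mat" where
  "real_mat \<equiv> map_mat real_of_rat"


section \<open>Feasible sets with an integral relaxation\<close>

definition binary_vecs :: "nat \<Rightarrow> real vec set" where
  "binary_vecs n = {x \<in> carrier_vec n. \<forall>i < n. x $ i \<in> {0, 1}}"

definition one_vec :: "nat \<Rightarrow> real vec" where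
  "one_vec n = vec n (\<lambda>_. 1)"

definition binary_solutions :: "real mat \<Rightarrow> real vec \<Rightarrow> real vec set" where
  "binary_solutions H g = {x \<in> binary_vecs (dim_col H). H *\<^sub>v x \<ge> g}"

definition relaxation :: "real mat \<Rightarrow> real vec \<Rightarrow> real vec set" where
  "relaxation H g =
     {x \<in> carrier_vec (dim_col H). H *\<^sub>v x \<ge> g \<and> 0\<^sub>v (dim_col H) \<le> x \<and> x \<le> one_vec (dim_col H)}"

definition convex_hull_vec :: "nat \<Rightarrow> real vec set \<Rightarrow> real vec set" where
  "convex_hull_vec n S =
     {x \<in> carrier_vec n. \<exists>(k :: nat) w v.
        (\<forall>j < k. 0 \<le> w j \<and> v j \<in> S) \<and> (\<Sum>j<k. w j) = 1 \<and>
        (\<forall>i < n. x $ i = (\<Sum>j<k. w j * v j $ i))}"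

text \<open>A polyhedron is integral if it is the convex hull of its integral points.\<close>

definition integral_polyhedron :: "nat \<Rightarrow> real vec set \<Rightarrow> bool" where
  "integral_polyhedron n P \<longleftrightarrow> P = convex_hull_vec n {x \<in> P. \<forall>i < n. x $ i \<in> \<int>}"


section \<open>The two-stage problem with ellipsoidal uncertainty\<close>

definition norm2 :: "real vec \<Rightarrow> real" where
  "norm2 v = L2_set (\<lambda>i. v $ i) {..<dim_vec v}"

definition ellipsoid :: "real vec \<Rightarrow> real mat \<Rightarrow> real vec set" where
  "ellipsoid c A = {c + A *\<^sub>v \<delta> | \<delta>. \<delta> \<in> carrier_vec (dim_col A) \<and> norm2 \<delta> \<le> 1}"

definition two_stage_feasible :: "real mat \<Rightarrow> real vec \<Rightarrow> (real vec \<times> real vec) set" where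
  "two_stage_feasible H g =
     {(x, y). x \<in> binary_vecs (dim_col H) \<and> y \<in> carrier_vec (dim_col H) \<and>
        H *\<^sub>v (y + x) \<ge> g \<and> x + y \<le> one_vec (dim_col H) \<and> 0\<^sub>v (dim_col H) \<le> y}"

definition two_stage_cost ::
  "real vec \<Rightarrow> real vec \<Rightarrow> real mat \<Rightarrow> real vec \<times> real vec \<Rightarrow> real" where
  "two_stage_cost C c A = (\<lambda>(x, y). C \<bullet> x + c \<bullet> y + norm2 (A\<^sup>T *\<^sub>v y))"

text \<open>
  A class of feasible sets is given by a set \<open>D\<close> of descriptions together with maps \<open>H\<close> and \<open>g\<close>
  from descriptions to constraint systems; the dimension \<open>n\<close> is the number of columns of \<open>H d\<close>.
  For explicitly given systems \<open>d\<close> just lists the entries. In combinatorial examples \<open>d\<close> is,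
  say, a graph, and \<open>H d\<close> may have exponentially many rows.
\<close>

definition deterministic_instances ::
  "int list set \<Rightarrow> (int list \<Rightarrow> real mat) \<Rightarrow> (int list \<times> rat vec) set" where
  "deterministic_instances D H =
     {(d, C). d \<in> D \<and> C \<in> carrier_vec (dim_col (H d)) \<and> 0\<^sub>v (dim_col (H d)) \<le> C}"

definition enc_deterministic :: "int list \<times> rat vec \<Rightarrow> int list list" where
  "enc_deterministic = (\<lambda>(d, C). d # enc_vec C)"

definition two_stage_instances ::
  "int list set \<Rightarrow> (int list \<Rightarrow> real mat) \<Rightarrow> (int list \<times> rat vec \<times> rat vec \<times> rat mat) set" where
  "two_stage_instances D H =
     {(d, C, c, A). d \<in> D \<and> C \<in> carrier_vec (dim_col (H d)) \<and> 0\<^sub>v (dim_col (H d)) \<le> C \<and>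
        c \<in> carrier_vec (dim_col (H d)) \<and> A \<in> carrier_mat (dim_col (H d)) (dim_col (H d)) \<and>
        (\<forall>u \<in> ellipsoid (real_vec c) (real_mat A). 0\<^sub>v (dim_col (H d)) \<le> u)}"

definition enc_two_stage :: "int list \<times> rat vec \<times> rat vec \<times> rat mat \<Rightarrow> int list list" where
  "enc_two_stage = (\<lambda>(d, C, c, A). d # enc_vec C @ enc_vec c @ enc_mat A)"

definition deterministic_poly_solvable ::
  "int list set \<Rightarrow> (int list \<Rightarrow> real mat) \<Rightarrow> (int list \<Rightarrow> real vec) \<Rightarrow> bool" where
  "deterministic_poly_solvable D H g \<longleftrightarrow>
     poly_time_search (deterministic_instances D H) enc_deterministic
       (\<lambda>(d, C) r. solves (binary_solutions (H d) (g d)) (\<lambda>x. real_vec C \<bullet> x)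
          (map_option real_vec r))
       (enc_answer enc_vec)"

end

theory Submission
  imports Defs
begin

text \<open>
  Replacing the Euclidean norm of \<open>A\<^sup>T y\<close> by the sum of its (nonnegative) entries changes the
  objective by a factor between \<open>1\<close> and \<open>\<surd>n\<close> and makes it linear: item \<open>i\<close> then costs \<open>C i\<close> in the
  first stage and \<open>c i\<close> plus the \<open>i\<close>-th row sum of \<open>A\<close> in the second. In an optimal solution each
  item is bought in the cheaper stage, so the linear problem is the deterministic one with the minimum
  of both costs; since the relaxation is integral, fractional \<open>y\<close> are of no advantage.

  The deterministic solver expects reduced fractions. Multiplying all costs by the product of all
  denominators makes them integers, which keeps the optimal solutions and spares computing greatest
  common divisors; the product has polynomial bit size.
\<close>

section \<open>Running time of structured programs\<close>

text \<open>The running time is not tracked along the execution. For a fixed program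
  \<open>time_bound\<close> is a polynomial in one number \<open>N\<close>, valid as soon as all
  values are at most \<open>magnitude N\<close> in absolute value and no loop runs more than
  \<open>N\<close> times. Only these size conditions have to accompany the correctness proof, with
  \<open>N\<close> the input size. The bit sizes of all denominators are part of the input, hence
  their product is at most 2^N; scaled costs are then at most 2^(2N), sums along a row at most
  2^(3N), and the difference of two such costs at most 2^(3N+1), which \<open>magnitude\<close>
  covers with some slack.

  The solver is an arbitrary program, known to be correct only when started in the initial state of
  its instance. It is therefore renamed to the arrays from 13 on, and the preparation has to produce
  every cell of that initial state, zero cells included, while the arrays below 13 keep the data for
  splitting the solution. The solver is also specified for nonnegative costs only: this follows from
  nonnegative entries of \<open>A\<close> and from nonnegativity of \<open>c\<close>, which is the
  centre of the ellipsoid.\<close>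

fun nodes :: "expr \<Rightarrow> nat" where
  "nodes (Const k) = 1"
| "nodes (Read a e) = Suc (nodes e)"
| "nodes (Add e1 e2) = Suc (nodes e1 + nodes e2)"
| "nodes (Sub e1 e2) = Suc (nodes e1 + nodes e2)"
| "nodes (Mul e1 e2) = Suc (nodes e1 + nodes e2)"
| "nodes (Div e1 e2) = Suc (nodes e1 + nodes e2)"

definition magnitude :: "nat \<Rightarrow> int" where
  "magnitude N = 2 ^ (4 * N + 2)"

text \<open>These are exactly the values whose bit sizes \<open>cost\<close> adds up, so the node
  count times \<open>word_length N\<close> bounds the cost of an expression.\<close>

fun fits :: "nat \<Rightarrow> state \<Rightarrow> expr \<Rightarrow> bool" where
  "fits N \<sigma> (Const k) \<longleftrightarrow> \<bar>k\<bar> \<le> magnitude N"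
| "fits N \<sigma> (Read a e) \<longleftrightarrow> fits N \<sigma> e \<and> \<bar>\<sigma> a (val \<sigma> e)\<bar> \<le> magnitude N"
| "fits N \<sigma> (Add e1 e2) \<longleftrightarrow> fits N \<sigma> e1 \<and> fits N \<sigma> e2 \<and> \<bar>val \<sigma> e1 + val \<sigma> e2\<bar> \<le> magnitude N"
| "fits N \<sigma> (Sub e1 e2) \<longleftrightarrow> fits N \<sigma> e1 \<and> fits N \<sigma> e2 \<and> \<bar>val \<sigma> e1 - val \<sigma> e2\<bar> \<le> magnitude N"
| "fits N \<sigma> (Mul e1 e2) \<longleftrightarrow> fits N \<sigma> e1 \<and> fits N \<sigma> e2 \<and> \<bar>val \<sigma> e1 * val \<sigma> e2\<bar> \<le> magnitude N"
| "fits N \<sigma> (Div e1 e2) \<longleftrightarrow> fits N \<sigma> e1 \<and> fits N \<sigma> e2 \<and> \<bar>val \<sigma> e1 div val \<sigma> e2\<bar> \<le> magnitude N"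

lemma bit_size_le:
  assumes "\<bar>k\<bar> \<le> 2 ^ m"
  shows "bit_size k \<le> m + 2"
proof -
  have "nat \<bar>k\<bar> < 2 ^ Suc m"
    using assms zero_less_power[of "2 :: int" m] by (simp add: nat_less_iff del: zero_less_power)
  then have "floorlog 2 (nat \<bar>k\<bar>) \<le> Suc m"
    by (intro floorlog_leI) auto
  then show ?thesis
    by (simp add: bit_size_def)
qed

lemma abs_le_bit_size: "\<bar>k\<bar> \<le> 2 ^ bit_size k"
proof (cases "k = 0")
  case False
  then have "nat \<bar>k\<bar> < 2 ^ floorlog 2 (nat \<bar>k\<bar>)"
    using floorlog_bounds[of "nat \<bar>k\<bar>" 2] by simp
  then have "\<bar>k\<bar> < 2 ^ floorlog 2 (nat \<bar>k\<bar>)"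
    by (simp add: nat_less_iff)
  also have "\<dots> \<le> 2 ^ bit_size k"
    by (simp add: bit_size_def)
  finally show ?thesis by simp
qed simp

abbreviation word_length :: "nat \<Rightarrow> nat" where
  "word_length N \<equiv> 4 * N + 4"

lemma bit_size_magnitude: "\<bar>k\<bar> \<le> magnitude N \<Longrightarrow> bit_size k \<le> word_length N"
  unfolding magnitude_def using bit_size_le[of k "4 * N + 2"] by simp

lemma cost_le: "fits N \<sigma> e \<Longrightarrow> cost \<sigma> e \<le> nodes e * word_length N"
proof (induction e)
  case (Read a e)
  then show ?case using bit_size_magnitude[of "\<sigma> a (val \<sigma> e)" N] by auto
next
  case (Add e1 e2)
  then show ?case using bit_size_magnitude[of "val \<sigma> e1 + val \<sigma> e2" N]
    by (simp add: add_mult_distrib)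
next
  case (Sub e1 e2)
  then show ?case using bit_size_magnitude[of "val \<sigma> e1 - val \<sigma> e2" N]
    by (simp add: add_mult_distrib)
next
  case (Mul e1 e2)
  then show ?case using bit_size_magnitude[of "val \<sigma> e1 * val \<sigma> e2" N]
    by (simp add: add_mult_distrib)
next
  case (Div e1 e2)
  then show ?case using bit_size_magnitude[of "val \<sigma> e1 div val \<sigma> e2" N]
    by (simp add: add_mult_distrib)
qed (use bit_size_magnitude in simp)

text \<open>Valid for runs that stay \<^const>\<open>fits\<close> \<open>N\<close> and in which no loop is iterated more than \<open>N\<close> times.\<close>

fun time_bound :: "nat \<Rightarrow> com \<Rightarrow> nat" where
  "time_bound N Skip = 1"
| "time_bound N (Store a e1 e2) = 1 + nodes e1 * word_length N + nodes e2 * word_length N"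
| "time_bound N (Seq c1 c2) = 1 + time_bound N c1 + time_bound N c2"
| "time_bound N (IfPos e c1 c2) = 1 + nodes e * word_length N + time_bound N c1 + time_bound N c2"
| "time_bound N (WhilePos e c) = (N + 1) * (1 + nodes e * word_length N + time_bound N c)"

definition polynomial_fun :: "(nat \<Rightarrow> nat) \<Rightarrow> bool" where
  "polynomial_fun f \<longleftrightarrow> (\<exists>q :: nat poly. \<forall>N. f N = poly q N)"

lemma polynomial_fun_const: "polynomial_fun (\<lambda>N. k)"
  unfolding polynomial_fun_def by (rule exI[of _ "[:k:]"]) simp

lemma polynomial_fun_id: "polynomial_fun (\<lambda>N. N)"
  unfolding polynomial_fun_def by (rule exI[of _ "[:0, 1:]"]) simp

lemma polynomial_fun_add:
  "polynomial_fun f \<Longrightarrow> polynomial_fun g \<Longrightarrow> polynomial_fun (\<lambda>N. f N + g N)"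
  unfolding polynomial_fun_def by (metis poly_add)

lemma polynomial_fun_mult:
  "polynomial_fun f \<Longrightarrow> polynomial_fun g \<Longrightarrow> polynomial_fun (\<lambda>N. f N * g N)"
  unfolding polynomial_fun_def by (metis poly_mult)

lemma polynomial_fun_poly: "polynomial_fun f \<Longrightarrow> polynomial_fun (\<lambda>N. poly q (f N))"
  unfolding polynomial_fun_def by (metis poly_pcompose)

lemmas polynomial_fun_intros =
  polynomial_fun_const polynomial_fun_id polynomial_fun_add polynomial_fun_mult polynomial_fun_poly

text \<open>A conditional is charged for both branches instead of the dearer one, so every clause of
  \<open>time_bound\<close> is built from sums and products alone.\<close>

lemma polynomial_fun_time_bound: "polynomial_fun (\<lambda>N. time_bound N c)"
  by (induction c) (simp_all only: time_bound.simps, (intro polynomial_fun_intros; assumption)+)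

lemma poly_nat_mono: "m \<le> n \<Longrightarrow> poly q m \<le> poly (q :: nat poly) n"
  by (induction q) (auto intro!: add_mono mult_mono)

text \<open>Acts as a weakest precondition for total correctness. The time bound is part of it, so
  the rules below leave only \<open>fits\<close> conditions and facts about the final state to be
  proved.\<close>

definition runs :: "nat \<Rightarrow> state \<Rightarrow> com \<Rightarrow> (state \<Rightarrow> bool) \<Rightarrow> bool" where
  "runs N \<sigma> c Q \<longleftrightarrow> (\<exists>t \<tau>. exec c \<sigma> t \<tau> \<and> t \<le> time_bound N c \<and> Q \<tau>)"

lemma runs_Store:
  assumes "fits N \<sigma> e1" "fits N \<sigma> e2" "Q (store \<sigma> a (val \<sigma> e1) (val \<sigma> e2))"
  shows "runs N \<sigma> (Store a e1 e2) Q"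
proof -
  have "1 + cost \<sigma> e1 + cost \<sigma> e2 \<le> time_bound N (Store a e1 e2)"
    using cost_le[OF assms(1)] cost_le[OF assms(2)] by simp
  then show ?thesis
    unfolding runs_def using exec_Store assms(3) by blast
qed

lemma runs_Seq:
  assumes "runs N \<sigma> c (\<lambda>\<tau>. runs N \<tau> d Q)"
  shows "runs N \<sigma> (Seq c d) Q"
proof -
  obtain s \<tau> t \<upsilon> where "exec c \<sigma> s \<tau>" "s \<le> time_bound N c"
    and "exec d \<tau> t \<upsilon>" "t \<le> time_bound N d" "Q \<upsilon>"
    using assms unfolding runs_def by blast
  then show ?thesis
    unfolding runs_def by (intro exI[of _ "1 + s + t"] exI[of _ \<upsilon>]) (use exec_Seq in auto)
qed

lemma runs_IfPos:
  assumes "fits N \<sigma> e" "val \<sigma> e > 0 \<Longrightarrow> runs N \<sigma> c Q" "val \<sigma> e \<le> 0 \<Longrightarrow> runs N \<sigma> d Q"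
  shows "runs N \<sigma> (IfPos e c d) Q"
proof (cases "val \<sigma> e > 0")
  case True
  then obtain t \<tau> where "exec c \<sigma> t \<tau>" "t \<le> time_bound N c" "Q \<tau>"
    using assms(2) unfolding runs_def by blast
  then show ?thesis
    unfolding runs_def using True cost_le[OF assms(1)]
    by (intro exI[of _ "1 + cost \<sigma> e + t"] exI[of _ \<tau>]) (use exec_IfTrue in auto)
next
  case False
  then obtain t \<tau> where "exec d \<sigma> t \<tau>" "t \<le> time_bound N d" "Q \<tau>"
    using assms(3) unfolding runs_def by force
  then show ?thesis
    unfolding runs_def using False cost_le[OF assms(1)]
    by (intro exI[of _ "1 + cost \<sigma> e + t"] exI[of _ \<tau>]) (use exec_IfFalse in auto)
qed

lemma runs_weaken: "runs N \<sigma> c Q \<Longrightarrow> (\<And>\<tau>. Q \<tau> \<Longrightarrow> R \<tau>) \<Longrightarrow> runs N \<sigma> c R"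
  unfolding runs_def by blast

section \<open>Counting loops\<close>

lemma exec_WhilePos_iterate:
  assumes step: "\<And>k \<tau>. k < m \<Longrightarrow> Inv k \<tau> \<Longrightarrow> val \<tau> e > 0 \<and> cost \<tau> e \<le> G
      \<and> (\<exists>t \<upsilon>. exec c \<tau> t \<upsilon> \<and> t \<le> T \<and> Inv (Suc k) \<upsilon>)"
    and stop: "\<And>\<tau>. Inv m \<tau> \<Longrightarrow> val \<tau> e \<le> 0 \<and> cost \<tau> e \<le> G"
    and start: "Inv k \<sigma>" "k \<le> m"
  shows "\<exists>t \<tau>. exec (WhilePos e c) \<sigma> t \<tau> \<and> t \<le> (m - k) * (1 + G + T) + 1 + G \<and> Inv m \<tau>"
  using start
proof (induction "m - k" arbitrary: k \<sigma>)
  case 0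
  then have "Inv m \<sigma>" by simp
  then show ?case
    using stop exec_WhileFalse[of \<sigma> e c] 0 by fastforce
next
  case (Suc l)
  then have "k < m" by simp
  then obtain s \<tau> where s: "val \<sigma> e > 0" "cost \<sigma> e \<le> G" "exec c \<sigma> s \<tau>" "s \<le> T" "Inv (Suc k) \<tau>"
    using step Suc.prems by blast
  have "l = m - Suc k"
    using Suc.hyps(2) by simp
  with Suc.hyps(1)[OF this s(5)] \<open>k < m\<close>
  obtain t \<upsilon> where t: "exec (WhilePos e c) \<tau> t \<upsilon>" "t \<le> l * (1 + G + T) + 1 + G" "Inv m \<upsilon>"
    by auto
  have "1 + cost \<sigma> e + s + t \<le> Suc l * (1 + G + T) + 1 + G"
    using s t by simp
  then show ?case
    using exec_WhileTrue[OF s(1,3) t(1)] t(3) Suc.hyps(2) by metis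
qed

definition var :: "nat \<Rightarrow> expr" where
  "var v = Read v (Const 0)"

definition assign :: "nat \<Rightarrow> expr \<Rightarrow> com" where
  "assign v e = Store v (Const 0) e"

text \<open>The counter is increased before the body, so the body sees 1, 2, and so on, which are
  the indices of array entries. The limit \<open>var b\<close> is cell 0 of array \<open>b\<close>,
  where an array keeps its length.\<close>

definition for_loop :: "nat \<Rightarrow> nat \<Rightarrow> com \<Rightarrow> com" where
  "for_loop v b c = Seq (assign v (Const 0))
     (WhilePos (Sub (var b) (var v)) (Seq (assign v (Add (var v) (Const 1))) c))"

lemma le_magnitude: "k \<le> N \<Longrightarrow> int k + 1 \<le> magnitude N"
proof -
  assume "k \<le> N"
  have "int N + 1 \<le> 2 ^ N"
    by (induction N) auto
  also have "(2 :: int) ^ N \<le> 2 ^ (4 * N + 2)"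
    by (intro power_increasing) auto
  finally show ?thesis
    using \<open>k \<le> N\<close> by (simp add: magnitude_def)
qed

lemma magnitude_ge: "0 \<le> magnitude N" "1 \<le> magnitude N"
  using le_magnitude[of 0 N] by simp_all

text \<open>\<open>Inv\<close> has to survive arbitrary writes to the counter cell, since the loop
  changes it between two rounds; the counter is tracked separately, and the body must leave it at
  its value. At most \<open>N\<close> rounds and one failing test are what the factor
  \<open>N + 1\<close> in \<open>time_bound\<close> pays for.\<close>

lemma runs_for_loop:
  assumes step: "\<And>k \<tau>. k < m \<Longrightarrow> Inv k \<tau> \<Longrightarrow> \<tau> v 0 = int k + 1 \<Longrightarrow>
      runs N \<tau> c (\<lambda>\<upsilon>. Inv (Suc k) \<upsilon> \<and> \<upsilon> v 0 = int k + 1)"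
    and counter: "\<And>k \<tau> x. Inv k \<tau> \<Longrightarrow> Inv k (store \<tau> v 0 x)"
    and bound: "\<And>k \<tau>. Inv k \<tau> \<Longrightarrow> \<tau> b 0 = int m"
    and "m \<le> N" "v \<noteq> b" "Inv 0 \<sigma>" "\<And>\<tau>. Inv m \<tau> \<Longrightarrow> Q \<tau>"
  shows "runs N \<sigma> (for_loop v b c) Q"
proof -
  let ?e = "Sub (var b) (var v)"
  let ?c = "Seq (assign v (Add (var v) (Const 1))) c"
  let ?I = "\<lambda>k \<tau>. Inv k \<tau> \<and> \<tau> v 0 = int k"
  have mag: "\<bar>int k\<bar> \<le> magnitude N" "\<bar>int k + 1\<bar> \<le> magnitude N" if "k \<le> m" for k
    using le_magnitude[of k N] that \<open>m \<le> N\<close> by auto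
  have mag_const: "1 \<le> magnitude N"
    using mag(2)[of 0] by simp
  have guard: "val \<tau> ?e = int m - int k \<and> cost \<tau> ?e \<le> nodes ?e * word_length N"
    if "?I k \<tau>" "k \<le> m" for k \<tau>
  proof -
    have "fits N \<tau> ?e"
      using that bound[of k \<tau>] mag[of k] mag[of m] mag_const by (auto simp: var_def)
    then show ?thesis
      using cost_le[of N \<tau> ?e] that bound[of k \<tau>] by (auto simp: var_def)
  qed
  have body: "runs N \<tau> ?c (?I (Suc k))" if "k < m" "?I k \<tau>" for k \<tau>
    unfolding assign_def
  proof (intro runs_Seq runs_Store)
    show "runs N (store \<tau> v (val \<tau> (Const 0)) (val \<tau> (Add (var v) (Const 1)))) c (?I (Suc k))"
      using step[of k "store \<tau> v 0 (int k + 1)"] counter[of k \<tau>] that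
      by (auto simp: var_def store_def elim!: runs_weaken)
  qed (use that mag[of k] mag_const in \<open>auto simp: var_def\<close>)
  have loop: "runs N \<tau> (WhilePos ?e ?c) Q" if "?I 0 \<tau>" for \<tau>
  proof -
    have "\<exists>t \<upsilon>. exec (WhilePos ?e ?c) \<tau> t \<upsilon>
        \<and> t \<le> (m - 0) * (1 + nodes ?e * word_length N + time_bound N ?c) + 1 + nodes ?e * word_length N
        \<and> ?I m \<upsilon>"
    proof (rule exec_WhilePos_iterate)
      fix k \<upsilon> assume "k < m" "?I k \<upsilon>"
      then show "val \<upsilon> ?e > 0 \<and> cost \<upsilon> ?e \<le> nodes ?e * word_length N
          \<and> (\<exists>t \<omega>. exec ?c \<upsilon> t \<omega> \<and> t \<le> time_bound N ?c \<and> ?I (Suc k) \<omega>)"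
        using guard[of k \<upsilon>] body[of k \<upsilon>] unfolding runs_def by auto
    next
      show "val \<upsilon> ?e \<le> 0 \<and> cost \<upsilon> ?e \<le> nodes ?e * word_length N" if "?I m \<upsilon>" for \<upsilon>
        using guard[of m \<upsilon>] that by auto
    qed (use that in auto)
    then obtain t \<upsilon> where t: "exec (WhilePos ?e ?c) \<tau> t \<upsilon>" "?I m \<upsilon>"
      "t \<le> m * (1 + nodes ?e * word_length N + time_bound N ?c) + 1 + nodes ?e * word_length N"
      by auto
    have "s \<le> (N + 1) * (1 + g + T)" if "s \<le> m * (1 + g + T) + 1 + g" for s g T
    proof -
      have "s \<le> m * (1 + g + T) + (1 + g)"
        using that by simp
      also have "\<dots> \<le> N * (1 + g + T) + (1 + g + T)"
        using mult_le_mono1[OF \<open>m \<le> N\<close>, of "1 + g + T"] by (rule add_mono) simp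
      finally show ?thesis
        by simp
    qed
    with t(3) have "t \<le> time_bound N (WhilePos ?e ?c)"
      unfolding time_bound.simps(5) by blast
    then show ?thesis
      using t assms(7) unfolding runs_def by blast
  qed
  show ?thesis
    unfolding for_loop_def assign_def[of v "Const 0"]
    by (intro runs_Seq runs_Store)
      (use loop counter[OF assms(6)] mag(1)[of 0] in \<open>auto simp: store_def\<close>)
qed

section \<open>Running a program in a shifted part of the memory\<close>

fun shift_expr :: "nat \<Rightarrow> expr \<Rightarrow> expr" where
  "shift_expr K (Const k) = Const k"
| "shift_expr K (Read a e) = Read (a + K) (shift_expr K e)"
| "shift_expr K (Add e1 e2) = Add (shift_expr K e1) (shift_expr K e2)"
| "shift_expr K (Sub e1 e2) = Sub (shift_expr K e1) (shift_expr K e2)"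
| "shift_expr K (Mul e1 e2) = Mul (shift_expr K e1) (shift_expr K e2)"
| "shift_expr K (Div e1 e2) = Div (shift_expr K e1) (shift_expr K e2)"

fun shift_com :: "nat \<Rightarrow> com \<Rightarrow> com" where
  "shift_com K Skip = Skip"
| "shift_com K (Store a e1 e2) = Store (a + K) (shift_expr K e1) (shift_expr K e2)"
| "shift_com K (Seq c d) = Seq (shift_com K c) (shift_com K d)"
| "shift_com K (IfPos e c d) = IfPos (shift_expr K e) (shift_com K c) (shift_com K d)"
| "shift_com K (WhilePos e c) = WhilePos (shift_expr K e) (shift_com K c)"

lemma val_shift_expr: "val \<sigma> (shift_expr K e) = val (\<lambda>a. \<sigma> (a + K)) e"
  by (induction e) auto

lemma cost_shift_expr: "cost \<sigma> (shift_expr K e) = cost (\<lambda>a. \<sigma> (a + K)) e"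
  by (induction e) (auto simp: val_shift_expr)

text \<open>\<open>\<tau>\<close> is the private memory of the relocated program;
  \<open>\<sigma>\<close> supplies the first \<open>K\<close> arrays, which that program cannot
  reach.\<close>

definition overlay :: "nat \<Rightarrow> state \<Rightarrow> state \<Rightarrow> state" where
  "overlay K \<tau> \<sigma> a = (if a < K then \<sigma> a else \<tau> (a - K))"

lemma store_overlay: "store (overlay K \<tau> \<sigma>) (a + K) i v = overlay K (store \<tau> a i v) \<sigma>"
  by (auto simp: store_def overlay_def fun_eq_iff)

lemma val_overlay: "val (overlay K \<tau> \<sigma>) (shift_expr K e) = val \<tau> e"
  by (simp add: val_shift_expr overlay_def)

lemma cost_overlay: "cost (overlay K \<tau> \<sigma>) (shift_expr K e) = cost \<tau> e"
  by (simp add: cost_shift_expr overlay_def)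

text \<open>Array names are constants of the program and are not charged, so renaming them changes
  neither values nor running times.\<close>

lemma exec_shift_com:
  "exec p \<tau> t \<upsilon> \<Longrightarrow> exec (shift_com K p) (overlay K \<tau> \<sigma>) t (overlay K \<upsilon> \<sigma>)"
proof (induction rule: exec.induct)
  case (exec_Store a e1 e2 \<tau>)
  then show ?case
    using exec.exec_Store[of "a + K" "shift_expr K e1" "shift_expr K e2" "overlay K \<tau> \<sigma>"]
    by (simp add: val_overlay cost_overlay store_overlay)
next
  case (exec_IfTrue \<tau> e p t \<upsilon> q)
  then show ?case
    using exec.exec_IfTrue[of "overlay K \<tau> \<sigma>" "shift_expr K e"]
    by (simp add: val_overlay cost_overlay)
next
  case (exec_IfFalse \<tau> e p t \<upsilon> q)
  then show ?case
    using exec.exec_IfFalse[of "overlay K \<tau> \<sigma>" "shift_expr K e"]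
    by (simp add: val_overlay cost_overlay)
next
  case (exec_WhileTrue \<tau> e p s \<upsilon> t \<omega>)
  then show ?case
    using exec.exec_WhileTrue[of "overlay K \<tau> \<sigma>" "shift_expr K e"]
    by (simp add: val_overlay cost_overlay)
next
  case (exec_WhileFalse \<tau> e p)
  then show ?case
    using exec.exec_WhileFalse[of "overlay K \<tau> \<sigma>" "shift_expr K e"]
    by (simp add: val_overlay cost_overlay)
next
  case (exec_Seq p \<tau> s \<upsilon> q t \<omega>)
  then show ?case
    using exec.exec_Seq by fastforce
qed (use exec.exec_Skip in simp)


section \<open>Rounding to the deterministic problem\<close>

lemma nonneg_vec_index:
  fixes v :: "real vec"
  assumes "0\<^sub>v n \<le> v" "i < n"
  shows "0 \<le> v $ i"
  using assms by (auto simp: less_eq_vec_def)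

lemma relaxation_integral_points:
  assumes "x \<in> relaxation H g" "\<forall>i < dim_col H. x $ i \<in> \<int>"
  shows "x \<in> binary_solutions H g"
proof -
  have "x $ i \<in> {0, 1}" if "i < dim_col H" for i
  proof -
    have "x $ i \<in> \<int>"
      using assms(2) that by blast
    then obtain k where k: "x $ i = of_int k"
      by (rule Ints_cases)
    have "0\<^sub>v (dim_col H) \<le> x" "x \<le> one_vec (dim_col H)"
      using assms(1) by (simp_all add: relaxation_def)
    then have "0 \<le> x $ i" "x $ i \<le> 1"
      using that nonneg_vec_index by (auto simp: less_eq_vec_def one_vec_def)
    then have "k = 0 \<or> k = 1"
      unfolding k by auto
    then show ?thesis
      using k by auto
  qed
  then show ?thesis
    using assms(1) by (auto simp: relaxation_def binary_solutions_def binary_vecs_def)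
qed

lemma binary_solutions_subset_relaxation: "binary_solutions H g \<subseteq> relaxation H g"
proof
  fix x assume x: "x \<in> binary_solutions H g"
  then have dim: "dim_vec x = dim_col H" and bin: "\<And>i. i < dim_col H \<Longrightarrow> x $ i = 0 \<or> x $ i = 1"
    by (auto simp: binary_solutions_def binary_vecs_def)
  have "0 \<le> x $ i" "x $ i \<le> 1" if "i < dim_col H" for i
    using bin[OF that] by auto
  then have "0\<^sub>v (dim_col H) \<le> x" "x \<le> one_vec (dim_col H)"
    using dim by (simp_all add: less_eq_vec_def one_vec_def)
  then show "x \<in> relaxation H g"
    using x by (simp add: relaxation_def binary_solutions_def binary_vecs_def)
qed

lemma relaxation_convex_combination:
  assumes "integral_polyhedron (dim_col H) (relaxation H g)" "w \<in> relaxation H g"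
  obtains k :: nat and \<mu> v where "\<forall>j<k. 0 \<le> \<mu> j \<and> v j \<in> binary_solutions H g" "(\<Sum>j<k. \<mu> j) = 1"
    "\<forall>i<dim_col H. w $ i = (\<Sum>j<k. \<mu> j * v j $ i)"
proof -
  have "w \<in> convex_hull_vec (dim_col H) {x \<in> relaxation H g. \<forall>i<dim_col H. x $ i \<in> \<int>}"
    using assms unfolding integral_polyhedron_def by blast
  then obtain k :: nat and \<mu> v where
    "\<forall>j<k. 0 \<le> \<mu> j \<and> v j \<in> {x \<in> relaxation H g. \<forall>i<dim_col H. x $ i \<in> \<int>}"
    "(\<Sum>j<k. \<mu> j) = 1" "\<forall>i<dim_col H. w $ i = (\<Sum>j<k. \<mu> j * v j $ i)"
    unfolding convex_hull_vec_def by blast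
  then show ?thesis
    using that relaxation_integral_points by blast
qed

text \<open>A linear function at a convex combination is the same combination of its values at
  binary solutions, each of which is at least \<open>m\<close>.\<close>

lemma relaxation_lower_bound:
  assumes "integral_polyhedron (dim_col H) (relaxation H g)" "w \<in> relaxation H g"
    and e: "e \<in> carrier_vec (dim_col H)" and m: "\<And>z. z \<in> binary_solutions H g \<Longrightarrow> m \<le> e \<bullet> z"
  shows "m \<le> e \<bullet> w"
proof -
  obtain k :: nat and \<mu> v where v: "\<forall>j<k. 0 \<le> \<mu> j \<and> v j \<in> binary_solutions H g"
    and sum: "(\<Sum>j<k. \<mu> j) = 1" and w: "\<forall>i<dim_col H. w $ i = (\<Sum>j<k. \<mu> j * v j $ i)"
    using relaxation_convex_combination[OF assms(1,2)] .
  have dims: "dim_vec w = dim_col H" "\<And>z. z \<in> binary_solutions H g \<Longrightarrow> dim_vec z = dim_col H"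
    using assms(2) by (auto simp: relaxation_def binary_solutions_def binary_vecs_def)
  have "m = (\<Sum>j<k. \<mu> j * m)"
    using sum by (simp flip: sum_distrib_right)
  also have "\<dots> \<le> (\<Sum>j<k. \<mu> j * (e \<bullet> v j))"
    using v m by (intro sum_mono mult_left_mono) auto
  also have "\<dots> = (\<Sum>j<k. \<Sum>i<dim_col H. e $ i * (\<mu> j * v j $ i))"
    using v dims by (intro sum.cong)
      (auto simp: scalar_prod_def sum_distrib_left atLeast0LessThan mult.left_commute)
  also have "\<dots> = (\<Sum>i<dim_col H. e $ i * w $ i)"
    using w by (subst sum.swap) (simp add: sum_distrib_left)
  also have "\<dots> = e \<bullet> w"
    using dims by (simp add: scalar_prod_def atLeast0LessThan)
  finally show ?thesis .
qed

text \<open>Weights with sum 1 require at least one point, as \<open>k = 0\<close> would give sum 0.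
  This carries the answer \<open>None\<close> of the solver over to the two-stage problem.\<close>

lemma binary_solutions_empty_iff:
  assumes "integral_polyhedron (dim_col H) (relaxation H g)"
  shows "binary_solutions H g = {} \<longleftrightarrow> relaxation H g = {}"
proof
  assume empty: "binary_solutions H g = {}"
  show "relaxation H g = {}"
  proof (rule ccontr)
    assume "relaxation H g \<noteq> {}"
    then obtain w where "w \<in> relaxation H g" by blast
    from relaxation_convex_combination[OF assms this] obtain k :: nat and \<mu> :: "nat \<Rightarrow> real" and v where
      "\<forall>j<k. 0 \<le> \<mu> j \<and> v j \<in> binary_solutions H g" "(\<Sum>j<k. \<mu> j) = 1"
      by metis
    then show False
      using empty by (cases k) auto
  qed
qed (use binary_solutions_subset_relaxation in blast)

section \<open>Comparing the Euclidean norm with a linear objective\<close>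

definition item_cost :: "real vec \<Rightarrow> real mat \<Rightarrow> nat \<Rightarrow> real" where
  "item_cost c A i = c $ i + (\<Sum>j<dim_col A. A $$ (i, j))"

definition linear_cost :: "real vec \<Rightarrow> real vec \<Rightarrow> real mat \<Rightarrow> real vec \<times> real vec \<Rightarrow> real" where
  "linear_cost C c A = (\<lambda>(x, y). \<Sum>i<dim_col A. C $ i * x $ i + item_cost c A i * y $ i)"

text \<open>The entries of the transpose of \<open>A\<close> times \<open>y\<close> are nonnegative,
  so their Euclidean norm is at most their sum; the converse estimate is the Cauchy-Schwarz
  inequality with the all-ones vector. The remaining terms are nonnegative and can only grow under a
  factor of at least 1.\<close>

lemma two_stage_cost_linear_cost:
  assumes C: "C \<in> carrier_vec n" "0\<^sub>v n \<le> C" and c: "c \<in> carrier_vec n" "0\<^sub>v n \<le> c"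
    and A: "A \<in> carrier_mat n n" "\<And>i j. i < n \<Longrightarrow> j < n \<Longrightarrow> 0 \<le> A $$ (i, j)"
    and x: "x \<in> carrier_vec n" "0\<^sub>v n \<le> x" and y: "y \<in> carrier_vec n" "0\<^sub>v n \<le> y"
  shows "two_stage_cost C c A (x, y) \<le> linear_cost C c A (x, y)"
    and "linear_cost C c A (x, y) \<le> sqrt (real n) * two_stage_cost C c A (x, y)"
proof -
  define b where "b i = (\<Sum>j<n. A $$ (j, i) * y $ j)" for i
  have pos: "0 \<le> C $ i" "0 \<le> c $ i" "0 \<le> x $ i" "0 \<le> y $ i" if "i < n" for i
    using that by (simp_all add: nonneg_vec_index[OF C(2)] nonneg_vec_index[OF c(2)]
        nonneg_vec_index[OF x(2)] nonneg_vec_index[OF y(2)])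
  have b_pos: "0 \<le> b i" if "i < n" for i
    unfolding b_def by (rule sum_nonneg) (use A(2) pos(4) that in simp)
  have "(A\<^sup>T *\<^sub>v y) $ i = b i" if "i < n" for i
    using A(1) y that by (auto simp: b_def scalar_prod_def atLeast0LessThan)
  then have norm: "norm2 (A\<^sup>T *\<^sub>v y) = L2_set b {..<n}"
    unfolding norm2_def using A(1) by (intro L2_set_cong) auto
  have cost: "two_stage_cost C c A (x, y) = (\<Sum>i<n. C $ i * x $ i) + (\<Sum>i<n. c $ i * y $ i) + L2_set b {..<n}"
    using x y norm by (simp add: two_stage_cost_def scalar_prod_def atLeast0LessThan)
  \<comment> \<open>Exchanging the sums turns column-wise entries into row sums of \<open>A\<close>
    weighted by \<open>y\<close>.\<close>
  have "(\<Sum>i<n. b i) = (\<Sum>i<n. (\<Sum>j<n. A $$ (i, j)) * y $ i)"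
    unfolding b_def by (subst sum.swap) (simp add: sum_distrib_right)
  then have linear: "linear_cost C c A (x, y) = (\<Sum>i<n. C $ i * x $ i) + (\<Sum>i<n. c $ i * y $ i) + (\<Sum>i<n. b i)"
    using A(1) by (simp add: linear_cost_def item_cost_def distrib_right sum.distrib)
  show "two_stage_cost C c A (x, y) \<le> linear_cost C c A (x, y)"
    unfolding cost linear using b_pos by (intro add_left_mono L2_set_le_sum) auto
  have "(\<Sum>i<n. \<bar>b i\<bar> * \<bar>1\<bar>) \<le> L2_set b {..<n} * L2_set (\<lambda>_. 1) {..<n}"
    by (rule L2_set_mult_ineq)
  then have norm_le: "(\<Sum>i<n. b i) \<le> sqrt (real n) * L2_set b {..<n}"
    using b_pos by (simp add: L2_set_constant mult.commute)
  have rest: "0 \<le> (\<Sum>i<n. C $ i * x $ i) + (\<Sum>i<n. c $ i * y $ i)"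
    using pos by (intro add_nonneg_nonneg sum_nonneg mult_nonneg_nonneg) auto
  show "linear_cost C c A (x, y) \<le> sqrt (real n) * two_stage_cost C c A (x, y)"
  \<comment> \<open>For \<open>n = 0\<close> the factor is 0 instead of at least 1, but then all
    sums are empty.\<close>
  proof (cases "n = 0")
    case False
    then have "1 \<le> sqrt (real n)"
      by simp
    then have "(\<Sum>i<n. C $ i * x $ i) + (\<Sum>i<n. c $ i * y $ i)
        \<le> sqrt (real n) * ((\<Sum>i<n. C $ i * x $ i) + (\<Sum>i<n. c $ i * y $ i))"
      using mult_right_mono[OF \<open>1 \<le> sqrt (real n)\<close> rest] by simp
    from add_mono[OF this norm_le] show ?thesis
      unfolding cost linear by (simp only: distrib_left)
  qed (simp add: linear)
qed

text \<open>Ties go to the second stage, in agreement with \<open>chosen\<close> and with the strict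
  test in the program.\<close>

definition split_vec :: "real vec \<Rightarrow> real vec \<Rightarrow> real mat \<Rightarrow> real vec \<Rightarrow> real vec \<times> real vec" where
  "split_vec C c A z =
     (vec (dim_vec z) (\<lambda>i. if C $ i < item_cost c A i then z $ i else 0),
      vec (dim_vec z) (\<lambda>i. if C $ i < item_cost c A i then 0 else z $ i))"

text \<open>The factor \<open>s\<close> accounts for the solver seeing all costs multiplied by the
  common denominator; being positive, it affects no comparison.\<close>

lemma solves_within_split_vec:
  assumes n: "dim_col H = n" and int: "integral_polyhedron n (relaxation H g)"
    and C: "C \<in> carrier_vec n" "0\<^sub>v n \<le> C" and c: "c \<in> carrier_vec n" "0\<^sub>v n \<le> c"
    and A: "A \<in> carrier_mat n n" "\<And>i j. i < n \<Longrightarrow> j < n \<Longrightarrow> 0 \<le> A $$ (i, j)"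
    and e: "e \<in> carrier_vec n" "\<And>i. i < n \<Longrightarrow> e $ i = s * min (C $ i) (item_cost c A i)" and s: "s > 0"
    and r: "solves (binary_solutions H g) (\<lambda>z. e \<bullet> z) r"
  shows "solves_within (sqrt (real n)) (two_stage_feasible H g) (two_stage_cost C c A)
    (map_option (split_vec C c A) r)"
proof -
  note int' = int[folded n]
  let ?F = "two_stage_feasible H g" and ?f = "two_stage_cost C c A" and ?l = "linear_cost C c A"
  have feasible: "x \<in> carrier_vec n" "0\<^sub>v n \<le> x" "y \<in> carrier_vec n" "0\<^sub>v n \<le> y" "x + y \<in> relaxation H g"
    if "(x, y) \<in> ?F" for x y
  proof -
    have bin: "x $ i = 0 \<or> x $ i = 1" if "i < n" for i
      using \<open>(x, y) \<in> ?F\<close> that n by (simp add: two_stage_feasible_def binary_vecs_def)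
    have "0 \<le> x $ i" if "i < n" for i
      using bin[OF that] by auto
    moreover show xy: "x \<in> carrier_vec n" "y \<in> carrier_vec n" "0\<^sub>v n \<le> y"
      using that n by (simp_all add: two_stage_feasible_def binary_vecs_def)
    ultimately show x_nonneg: "0\<^sub>v n \<le> x"
      by (simp add: less_eq_vec_def)
    have "0\<^sub>v n \<le> x + y"
      using xy nonneg_vec_index[OF x_nonneg] nonneg_vec_index[OF xy(3)] by (simp add: less_eq_vec_def)
    then show "x + y \<in> relaxation H g"
      using that n xy comm_add_vec[OF xy(1,2)] by (simp add: two_stage_feasible_def relaxation_def)
  qed
  have sandwich: "?f (x, y) \<le> ?l (x, y)" "?l (x, y) \<le> sqrt (real n) * ?f (x, y)" if "(x, y) \<in> ?F" for x y
    using two_stage_cost_linear_cost[OF C c A feasible(1-4)] that by blast+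
  show ?thesis
  proof (cases r)
    case None
    then have "relaxation H g = {}"
      using r binary_solutions_empty_iff[OF int'] by (simp add: solves_def)
    then have "?F = {}"
      using feasible(5) by auto
    then show ?thesis
      using None by (simp add: solves_within_def)
  next
    case (Some z)
    then have z: "z \<in> binary_solutions H g" "\<And>z'. z' \<in> binary_solutions H g \<Longrightarrow> e \<bullet> z \<le> e \<bullet> z'"
      using r by (auto simp: solves_def)
    have z01: "z \<in> carrier_vec n" "\<And>i. i < n \<Longrightarrow> z $ i \<in> {0, 1}"
      using z(1) n by (auto simp: binary_solutions_def binary_vecs_def)
    have z_dim: "dim_vec z = n"
      using z01(1) by simp
    obtain x y where xy: "split_vec C c A z = (x, y)"
      by fastforce
    then have x: "x = vec n (\<lambda>i. if C $ i < item_cost c A i then z $ i else 0)"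
      and y: "y = vec n (\<lambda>i. if C $ i < item_cost c A i then 0 else z $ i)"
      using z01(1) by (auto simp: split_vec_def)
    have sum: "x + y = z" "y + x = z"
      using z_dim by (auto simp: x y)
    have "x \<in> binary_vecs n"
      using z01(2) by (simp add: binary_vecs_def x z_dim)
    moreover have "y \<in> carrier_vec n" "0\<^sub>v n \<le> y"
      using z01(2) by (fastforce simp: y less_eq_vec_def)+
    moreover have "H *\<^sub>v z \<ge> g" "z \<le> one_vec n"
      using z(1) binary_solutions_subset_relaxation[of H g] n by (auto simp: relaxation_def)
    ultimately have F: "(x, y) \<in> ?F"
      using n sum by (simp add: two_stage_feasible_def)
    \<comment> \<open>Each item is paid only in the stage that attains the minimum. On a tie both
      costs agree, so it does not matter that \<open>min_def\<close> tests with \<open>\<le>\<close>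
      and \<open>split_vec\<close> with \<open><\<close>.\<close>
    have "s * ?l (x, y) = (\<Sum>i<n. s * (C $ i * x $ i + item_cost c A i * y $ i))"
      using A(1) by (simp add: linear_cost_def sum_distrib_left)
    also have "\<dots> = (\<Sum>i<n. e $ i * z $ i)"
      using e(2) by (intro sum.cong) (auto simp: x y min_def)
    finally have lxy: "s * ?l (x, y) = e \<bullet> z"
      using z_dim by (simp add: scalar_prod_def atLeast0LessThan)
    have optimal: "?f (x, y) \<le> sqrt (real n) * ?f s'" if "s' \<in> ?F" for s'
    proof -
      obtain x' y' where s': "s' = (x', y')"
        by fastforce
      note f = feasible[OF that[unfolded s']]
      \<comment> \<open>Here a fractional \<open>y'\<close> is dealt with: \<open>x' + y'\<close> is
        only known to lie in the relaxation, whose integrality still makes the cost of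
        \<open>z\<close> a lower bound.\<close>
      have "e \<bullet> z \<le> e \<bullet> (x' + y')"
        using relaxation_lower_bound[OF int' f(5)] e(1) z(2) n by blast
      also have "\<dots> = (\<Sum>i<n. e $ i * (x' $ i + y' $ i))"
        using f by (simp add: scalar_prod_def atLeast0LessThan)
      also have "\<dots> \<le> (\<Sum>i<n. s * (C $ i * x' $ i + item_cost c A i * y' $ i))"
      proof (rule sum_mono)
        fix i assume "i \<in> {..<n}"
        then have i: "i < n" "0 \<le> x' $ i" "0 \<le> y' $ i"
          using nonneg_vec_index[OF f(2)] nonneg_vec_index[OF f(4)] by auto
        let ?m = "min (C $ i) (item_cost c A i)"
        have "?m * x' $ i + ?m * y' $ i \<le> C $ i * x' $ i + item_cost c A i * y' $ i"
          using i by (intro add_mono mult_right_mono) auto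
        from mult_left_mono[OF this, of s]
        show "e $ i * (x' $ i + y' $ i) \<le> s * (C $ i * x' $ i + item_cost c A i * y' $ i)"
          using s i(1) e(2) by (simp add: mult.assoc distrib_left)
      qed
      also have "\<dots> = s * ?l (x', y')"
        using A(1) by (simp add: linear_cost_def sum_distrib_left)
      finally have "s * ?l (x, y) \<le> s * ?l (x', y')"
        unfolding lxy .
      then have "?l (x, y) \<le> ?l (x', y')"
        using s mult_le_cancel_left_pos by blast
      with sandwich(1)[OF F] have "?f (x, y) \<le> ?l (x', y')"
        by (rule order_trans)
      also have "\<dots> \<le> sqrt (real n) * ?f s'"
        unfolding s' using that s' by (intro sandwich(2)) simp
      finally show ?thesis .
    qed
    have "?f (x, y) \<le> sqrt (real n) * (INF s'\<in>?F. ?f s')"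
    \<comment> \<open>\<open>optimal\<close> is divided by the factor to obtain a lower bound on all
      values, hence on the infimum. For \<open>n = 0\<close> the right-hand side is 0, and
      \<open>optimal\<close> applied to the solution itself suffices.\<close>
    proof (cases "n = 0")
      case True
      then show ?thesis
        using optimal[OF F] by simp
    next
      case False
      have "?f (x, y) / sqrt (real n) \<le> (INF s'\<in>?F. ?f s')"
        using F optimal False by (intro cINF_greatest) (auto simp: divide_le_eq mult.commute)
      then show ?thesis
        using False by (simp add: divide_le_eq mult.commute)
    qed
    then show ?thesis
      using Some F xy by (simp add: solves_within_def)
  qed
qed


section \<open>The reduction as a program\<close>

text \<open>Variables 7 to 11 hold the common denominator, two loop counters and the two scaled costs of
  the current item; array 12 marks the items that are bought in the first stage. The memory of the
  deterministic solver starts at array 13.\<close>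

definition multiply_denominators :: "nat \<Rightarrow> com" where
  "multiply_denominators a = for_loop 8 a (assign 7 (Mul (var 7) (Read a (var 8))))"

text \<open>Numerators are in array \<open>a\<close>, denominators in the next one. The common
  denominator is a multiple of each denominator, so the division is exact.\<close>

definition scaled :: "nat \<Rightarrow> expr \<Rightarrow> expr" where
  "scaled a e = Mul (Read a e) (Div (var 7) (Read (Suc a) e))"

text \<open>The matrix lies row by row in array 5. As both counters start at 1, the entry in row i
  and column j has index (i - 1) * n + j; n is read from the length cell of array 1.\<close>

definition add_row :: com where
  "add_row = for_loop 9 1 (assign 10
     (Add (var 10) (scaled 5 (Add (Mul (Sub (var 8) (Const 1)) (var 1)) (var 9)))))"

text \<open>The second branch stores no mark: the cells of array 12 are 0 from the start, which
  \<open>array_Suc_zero\<close> exploits.\<close>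

definition select_cheaper :: com where
  "select_cheaper =
     IfPos (Sub (var 10) (var 11))
       (Seq (Store 12 (var 8) (Const 1)) (Store 14 (var 8) (var 11)))
       (Store 14 (var 8) (var 10))"

definition compute_costs :: com where
  "compute_costs = for_loop 8 1
     (Seq (assign 10 (scaled 3 (var 8)))
     (Seq add_row
     (Seq (assign 11 (scaled 1 (var 8)))
     (Seq (Store 15 (var 8) (Const 1)) select_cheaper))))"

text \<open>The length cells of arrays 13 to 15 are written last. Until then they are 0, so the loop
  invariants can describe these arrays by \<open>array\<close>.\<close>

definition prepare :: com where
  "prepare =
     Seq (assign 7 (Const 1))
     (Seq (multiply_denominators 2)
     (Seq (multiply_denominators 4)
     (Seq (multiply_denominators 6)
     (Seq compute_costs
     (Seq (for_loop 8 0 (Store 13 (var 8) (Read 0 (var 8))))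
     (Seq (assign 13 (var 0))
     (Seq (assign 14 (var 1)) (assign 15 (var 1)))))))))"

text \<open>Array 14 now holds the numerators of the solver's answer, whose entries 0 and 1 make all
  denominators 1. The output reuses arrays 1 to 4: their length cells already contain n, because
  both input cost vectors have n entries.\<close>

definition split_solution :: com where
  "split_solution = for_loop 8 1
     (Seq (Store 1 (var 8) (Mul (Read 12 (var 8)) (Read 14 (var 8))))
     (Seq (Store 2 (var 8) (Const 1))
     (Seq (Store 3 (var 8) (Mul (Sub (Const 1) (Read 12 (var 8))) (Read 14 (var 8))))
        (Store 4 (var 8) (Const 1)))))"

text \<open>Entry 1 of array 13 is the feasibility flag that \<open>enc_answer\<close> puts in
  front.\<close>

definition unpack :: com where
  "unpack = IfPos (Read 13 (Const 1))
     (Seq split_solution (Seq (assign 0 (Const 1)) (Store 0 (Const 1) (Const 1))))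
     (Seq (assign 0 (Const 1)) (Store 0 (Const 1) (Const 0)))"

text \<open>Prescribes every cell, also the length cell and those out of range, because the solver
  needs an exact initial state and not merely correct entries.\<close>

definition array :: "nat \<Rightarrow> (nat \<Rightarrow> int) \<Rightarrow> int \<Rightarrow> int" where
  "array m f i = (if 1 \<le> i \<and> i \<le> int m then f (nat i - 1) else 0)"

lemma array_0: "array 0 f = (\<lambda>_. 0)"
  by (auto simp: array_def)

lemma array_Suc: "array (Suc k) f = (array k f)(int k + 1 := f k)"
  by (auto simp: array_def fun_eq_iff nat_add_distrib)

lemma array_Suc_zero: "f k = 0 \<Longrightarrow> array (Suc k) f = array k f"
  unfolding array_Suc by (rule fun_upd_idem) (simp add: array_def)

lemma abs_div_le: "0 \<le> x \<Longrightarrow> 0 \<le> y \<Longrightarrow> \<bar>x div y\<bar> \<le> (x :: int)"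
  using zdiv_mono2[of x 1 y] by (cases "y = 0") (auto simp: div_int_pos_iff)

lemma power_le_magnitude: "k \<le> 4 * N + 2 \<Longrightarrow> 2 ^ k \<le> magnitude N"
  unfolding magnitude_def by (intro power_increasing) auto

lemma runs_Seq_post:
  "runs N \<sigma> c P \<Longrightarrow> (\<And>\<tau>. P \<tau> \<Longrightarrow> runs N \<tau> d Q) \<Longrightarrow> runs N \<sigma> (Seq c d) Q"
  by (rule runs_Seq) (rule runs_weaken)

section \<open>Results and number sizes of the preparation, in terms of the input cells\<close>

locale two_stage_memory =
  fixes N n L :: nat and \<sigma>0 :: state
  assumes cell_bound: "\<And>a i. \<bar>\<sigma>0 a i\<bar> \<le> 2 ^ N"
    and denominator_pos: "\<And>a k. a \<in> {2, 4, 6} \<Longrightarrow> int k < \<sigma>0 a 0 \<Longrightarrow> 0 < \<sigma>0 a (int k + 1)"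
    and denominator_nonneg: "\<And>a i. a \<in> {2, 4, 6} \<Longrightarrow> 0 \<le> \<sigma>0 a i"
    and length_description: "\<sigma>0 0 0 = int L"
    and length_vector: "\<And>a. a \<in> {1, 2, 3, 4} \<Longrightarrow> \<sigma>0 a 0 = int n"
    and length_matrix: "\<sigma>0 6 0 = int (n * n)"
    and size_bounds: "L \<le> N" "n \<le> N" "n * n \<le> N"
    and description_outside: "\<And>i. i < 0 \<or> i > int L \<Longrightarrow> \<sigma>0 0 i = 0"
    and unused: "\<And>a. a \<ge> 7 \<Longrightarrow> \<sigma>0 a = (\<lambda>_. 0)"
begin

definition denominators :: "nat \<Rightarrow> nat \<Rightarrow> int" where
  "denominators a m = (\<Prod>k<m. \<sigma>0 a (int k + 1))"

definition common_denominator :: int where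
  "common_denominator = denominators 2 n * denominators 4 n * denominators 6 (n * n)"

definition scaled_value :: "nat \<Rightarrow> nat \<Rightarrow> int" where
  "scaled_value a k = \<sigma>0 a (int k + 1) * (common_denominator div \<sigma>0 (Suc a) (int k + 1))"

definition second_stage :: "nat \<Rightarrow> int" where
  "second_stage k = scaled_value 3 k + (\<Sum>j<n. scaled_value 5 (k * n + j))"

definition first_stage :: "nat \<Rightarrow> int" where
  "first_stage k = scaled_value 1 k"

definition chosen :: "nat \<Rightarrow> int" where
  "chosen k = (if first_stage k < second_stage k then 1 else 0)"

definition cheaper :: "nat \<Rightarrow> int" where
  "cheaper k = min (first_stage k) (second_stage k)"

definition input_kept :: "state \<Rightarrow> bool" where
  "input_kept \<sigma> \<longleftrightarrow> (\<forall>a<7. \<sigma> a = \<sigma>0 a)"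

lemma input_keptD: "input_kept \<sigma> \<Longrightarrow> a < 7 \<Longrightarrow> \<sigma> a = \<sigma>0 a"
  by (simp add: input_kept_def)

lemma input_kept_store: "a \<ge> 7 \<Longrightarrow> input_kept (store \<sigma> a i v) \<longleftrightarrow> input_kept \<sigma>"
  by (auto simp: input_kept_def store_def)

lemma index_le_magnitude: "k < N \<Longrightarrow> int k + 1 \<le> magnitude N"
  using le_magnitude[of k N] by simp

lemma cell_le_magnitude: "\<bar>\<sigma>0 a i\<bar> \<le> magnitude N"
  using cell_bound[of a i] power_le_magnitude[of N N] by simp

lemma denominator_ge_1:
  assumes "a \<in> {2, 4, 6}" "int m \<le> \<sigma>0 a 0" "k < m"
  shows "1 \<le> \<sigma>0 a (int k + 1)"
  using denominator_pos[OF assms(1), of k] assms(2,3) by linarith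

lemma denominators_ge_1:
  assumes "a \<in> {2, 4, 6}" "int m \<le> \<sigma>0 a 0"
  shows "1 \<le> denominators a m"
  unfolding denominators_def
  by (rule prod_ge_1) (use denominator_ge_1[OF assms] in simp)

text \<open>All factors are at least 1, so a bound on the complete product bounds every intermediate
  value of the multiplication loop.\<close>

lemma denominators_mono:
  assumes "a \<in> {2, 4, 6}" "int m \<le> \<sigma>0 a 0" "k \<le> m"
  shows "denominators a k \<le> denominators a m"
  unfolding denominators_def
  by (rule prod_mono2) (use denominator_ge_1[OF assms(1,2)] denominator_nonneg[OF assms(1)] assms(3) in auto)

definition multiplied :: "int \<Rightarrow> state \<Rightarrow> bool" where
  "multiplied x \<sigma> \<longleftrightarrow> input_kept \<sigma> \<and> (\<forall>a>8. \<sigma> a = (\<lambda>_. 0)) \<and> \<sigma> 7 0 = x"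

lemma runs_multiply_denominators:
  assumes \<sigma>: "multiplied x \<sigma>"
    and a: "a \<in> {2, 4, 6}" and m: "\<sigma>0 a 0 = int m" "m \<le> N"
    and x: "1 \<le> x" "x * denominators a m \<le> 2 ^ N"
  shows "runs N \<sigma> (multiply_denominators a) (multiplied (x * denominators a m))"
  unfolding multiply_denominators_def
proof (rule runs_for_loop[where m = m and Inv = "\<lambda>k. multiplied (x * denominators a k)"])
  fix k \<tau>
  assume k: "k < m" and \<tau>: "multiplied (x * denominators a k) \<tau>" "\<tau> 8 0 = int k + 1"
  have \<tau>a: "\<tau> a = \<sigma>0 a"
    using \<tau>(1) a by (auto simp: multiplied_def input_kept_def)
  have partial: "\<bar>x * denominators a l\<bar> \<le> magnitude N" if "l \<le> m" for l
  proof -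
    have "0 \<le> x * denominators a l" "x * denominators a l \<le> x * denominators a m"
      using denominators_ge_1[OF a, of l] denominators_mono[OF a, of m l] m that x by auto
    then show ?thesis
      using x(2) power_le_magnitude[of N N] by simp
  qed
  have Suc: "denominators a (Suc k) = denominators a k * \<sigma>0 a (int k + 1)"
    by (simp add: denominators_def)
  show "runs N \<tau> (assign 7 (Mul (var 7) (Read a (var 8))))
      (\<lambda>\<upsilon>. multiplied (x * denominators a (Suc k)) \<upsilon> \<and> \<upsilon> 8 0 = int k + 1)"
    unfolding assign_def
  proof (rule runs_Store)
    show "fits N \<tau> (Mul (var 7) (Read a (var 8)))"
      using \<tau> \<tau>a partial[of k] partial[of "Suc k"] k magnitude_ge[of N] index_le_magnitude[of k]
        cell_le_magnitude m(2) Suc by (auto simp: var_def multiplied_def mult.assoc)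
  qed (use \<tau> \<tau>a Suc magnitude_ge[of N] in
      \<open>auto simp: multiplied_def var_def input_kept_store store_def[of _ 7] input_kept_def\<close>)
next
  fix k \<tau> y
  assume "multiplied (x * denominators a k) \<tau>"
  then show "multiplied (x * denominators a k) (store \<tau> 8 0 y)"
    by (auto simp: multiplied_def input_kept_store) (auto simp: store_def)
qed (use \<sigma> a m in \<open>auto simp: multiplied_def input_kept_def denominators_def\<close>)

lemma common_denominator_ge_1: "1 \<le> common_denominator"
proof -
  have "1 \<le> denominators 2 n" "1 \<le> denominators 4 n" "1 \<le> denominators 6 (n * n)"
    using denominators_ge_1 length_vector length_matrix by simp_all
  then show ?thesis
    unfolding common_denominator_def
    by (metis mult_mono' mult_1 zero_le_one)
qed

text \<open>The index is arbitrary: even where the denominator cell is 0 the quotient does not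
  exceed the dividend, since division by 0 yields 0.\<close>

lemma product_bound:
  assumes "common_denominator \<le> 2 ^ N" "odd a" "a < 7"
  shows "\<bar>\<sigma>0 a i * (common_denominator div \<sigma>0 (Suc a) i)\<bar> \<le> 2 ^ (2 * N)"
    "\<bar>common_denominator div \<sigma>0 (Suc a) i\<bar> \<le> 2 ^ N"
proof -
  have "a \<in> {1, 3, 5}"
    using assms(2,3) by (auto elim!: oddE)
  then have "\<bar>common_denominator div \<sigma>0 (Suc a) i\<bar> \<le> common_denominator"
    using common_denominator_ge_1 by (intro abs_div_le denominator_nonneg) auto
  then show le: "\<bar>common_denominator div \<sigma>0 (Suc a) i\<bar> \<le> 2 ^ N"
    using assms(1) by simp
  show "\<bar>\<sigma>0 a i * (common_denominator div \<sigma>0 (Suc a) i)\<bar> \<le> 2 ^ (2 * N)"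
    using mult_mono[OF cell_bound[of a i] le] by (simp add: abs_mult power_add mult_2)
qed

lemma scaled_value_bound:
  "common_denominator \<le> 2 ^ N \<Longrightarrow> odd a \<Longrightarrow> a < 7 \<Longrightarrow> \<bar>scaled_value a k\<bar> \<le> 2 ^ (2 * N)"
  unfolding scaled_value_def by (rule product_bound)

lemma fits_scaled:
  assumes "common_denominator \<le> 2 ^ N" "odd a" "a < 7"
    and "input_kept \<sigma>" "\<sigma> 7 0 = common_denominator" "fits N \<sigma> e"
  shows "fits N \<sigma> (scaled a e)"
proof -
  have "\<sigma> a = \<sigma>0 a" "\<sigma> (Suc a) = \<sigma>0 (Suc a)"
    using assms(2-4) by (auto simp: input_kept_def elim!: oddE)
  then show ?thesis
    using assms product_bound[OF assms(1-3), of "val \<sigma> e"] cell_le_magnitude common_denominator_ge_1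
      power_le_magnitude[of N N] power_le_magnitude[of "2 * N" N] magnitude_ge[of N]
    by (fastforce simp: scaled_def var_def)
qed

lemma val_scaled:
  assumes "odd a" "a < 7" "input_kept \<sigma>" "\<sigma> 7 0 = common_denominator" "val \<sigma> e = int k + 1"
  shows "val \<sigma> (scaled a e) = scaled_value a k"
proof -
  have "\<sigma> a = \<sigma>0 a" "\<sigma> (Suc a) = \<sigma>0 (Suc a)"
    using assms(1-3) by (auto simp: input_kept_def elim!: oddE)
  then show ?thesis
    using assms(4,5) by (simp add: scaled_def scaled_value_def var_def)
qed

definition partial_row :: "nat \<Rightarrow> nat \<Rightarrow> int" where
  "partial_row k m = scaled_value 3 k + (\<Sum>j<m. scaled_value 5 (k * n + j))"

text \<open>There are m + 1 terms of size at most 2^(2N), and m + 1 \<le> N + 1 \<le> 2^N.\<close>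

lemma partial_row_bound:
  assumes D: "common_denominator \<le> 2 ^ N" and m: "m \<le> n"
  shows "\<bar>partial_row k m\<bar> \<le> 2 ^ (3 * N)"
proof -
  have "\<bar>partial_row k m\<bar> \<le> \<bar>scaled_value 3 k\<bar> + (\<Sum>j<m. \<bar>scaled_value 5 (k * n + j)\<bar>)"
    unfolding partial_row_def by (rule order_trans[OF abs_triangle_ineq add_left_mono[OF sum_abs]])
  also have "\<dots> \<le> 2 ^ (2 * N) + (\<Sum>j<m. 2 ^ (2 * N))"
    using scaled_value_bound[OF D] by (intro add_mono sum_mono) simp_all
  also have "\<dots> = (int m + 1) * 2 ^ (2 * N)"
    by (simp add: algebra_simps)
  also have "\<dots> \<le> (int N + 1) * 2 ^ (2 * N)"
    using m size_bounds by (intro mult_right_mono) auto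
  also have "\<dots> \<le> 2 ^ N * 2 ^ (2 * N)"
  proof (rule mult_right_mono)
    show "int N + 1 \<le> 2 ^ N"
      by (induction N) auto
  qed simp
  finally show ?thesis
    by (simp flip: power_add)
qed

lemma partial_row_magnitude:
  "common_denominator \<le> 2 ^ N \<Longrightarrow> m \<le> n \<Longrightarrow> \<bar>partial_row k m\<bar> \<le> magnitude N"
  using partial_row_bound[of m k] power_le_magnitude[of "3 * N" N] by simp

text \<open>Nothing is said about arrays 8 to 11: they hold counters and scratch values and may be
  overwritten freely.\<close>

definition costs_computed :: "nat \<Rightarrow> state \<Rightarrow> bool" where
  "costs_computed k \<sigma> \<longleftrightarrow> input_kept \<sigma> \<and> \<sigma> 7 0 = common_denominator \<and> \<sigma> 12 = array k chosen \<and>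
     \<sigma> 13 = (\<lambda>_. 0) \<and> \<sigma> 14 = array k cheaper \<and> \<sigma> 15 = array k (\<lambda>_. 1) \<and> (\<forall>a>15. \<sigma> a = (\<lambda>_. 0))"

lemma costs_computed_store:
  "a \<in> {8, 9, 10, 11} \<Longrightarrow> costs_computed k (store \<sigma> a i v) \<longleftrightarrow> costs_computed k \<sigma>"
  by (auto simp: costs_computed_def input_kept_store) (auto simp: store_def)

lemma runs_add_row:
  assumes D: "common_denominator \<le> 2 ^ N"
    and \<sigma>: "costs_computed k \<sigma>" "\<sigma> 8 0 = int k + 1" "k < n" "\<sigma> 10 0 = scaled_value 3 k"
    and Q: "\<And>\<tau>. costs_computed k \<tau> \<Longrightarrow> \<tau> 8 0 = int k + 1 \<Longrightarrow> \<tau> 10 0 = second_stage k \<Longrightarrow> Q \<tau>"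
  shows "runs N \<sigma> add_row Q"
  unfolding add_row_def
proof (rule runs_for_loop[where m = n and Inv = "\<lambda>j \<tau>. costs_computed k \<tau> \<and>
      \<tau> 8 0 = int k + 1 \<and> \<tau> 10 0 = partial_row k j"], goal_cases)
  case (1 j \<tau>)
  let ?pos = "Add (Mul (Sub (var 8) (Const 1)) (var 1)) (var 9)"
  have \<tau>: "input_kept \<tau>" "\<tau> 7 0 = common_denominator" "\<tau> 1 = \<sigma>0 1"
    using 1 by (auto simp: costs_computed_def input_keptD)
  have pos: "val \<tau> ?pos = int (k * n + j) + 1"
    using 1 \<tau>(3) length_vector[of 1] by (simp add: var_def)
  have "k * n + j < Suc k * n"
    using 1 by simp
  also have "\<dots> \<le> n * n"
    using \<sigma>(3) by (intro mult_le_mono1) simp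
  also have "\<dots> \<le> N"
    by (rule size_bounds)
  finally have "int (k * n + j) + 1 \<le> magnitude N"
    by (rule index_le_magnitude)
  \<comment> \<open>\<open>fits\<close> also asks for the intermediate product in the address
    expression.\<close>
  moreover have "int (k * n) \<le> int (k * n + j) + 1"
    by simp
  moreover have "int k + 1 \<le> magnitude N" "int n \<le> magnitude N" "int j + 1 \<le> magnitude N"
    using index_le_magnitude[of k] le_magnitude[of n N] index_le_magnitude[of j] size_bounds \<sigma>(3) 1
    by auto
  ultimately have fits: "fits N \<tau> ?pos"
    using 1 \<tau>(3) length_vector[of 1] magnitude_ge[of N]
    by (simp add: var_def flip: of_nat_mult)
  have row: "partial_row k (Suc j) = partial_row k j + scaled_value 5 (k * n + j)"
    by (simp add: partial_row_def)
  have vs: "val \<tau> (scaled 5 ?pos) = scaled_value 5 (k * n + j)"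
    using \<tau> pos by (intro val_scaled) auto
  show ?case
    unfolding assign_def
  proof (rule runs_Store, goal_cases)
    case 2
    show ?case
      using fits_scaled[OF D _ _ \<tau>(1,2) fits, of 5] vs row 1 magnitude_ge[of N]
        partial_row_magnitude[OF D, of j k] partial_row_magnitude[OF D, of "Suc j" k]
      by (simp add: var_def)
  next
    case 3
    show ?case
      using 1 vs row by (simp add: costs_computed_store) (simp add: store_def var_def)
  qed (use magnitude_ge[of N] in simp)
qed (use \<sigma> Q size_bounds length_vector[of 1] in
    \<open>auto simp: costs_computed_store partial_row_def second_stage_def costs_computed_def input_keptD
      input_kept_store, auto simp: store_def\<close>)

lemma runs_select_cheaper:
  assumes D: "common_denominator \<le> 2 ^ N" and k: "k < n"
    and \<sigma>: "input_kept \<sigma>" "\<sigma> 7 0 = common_denominator" "\<sigma> 12 = array k chosen"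
      "\<sigma> 13 = (\<lambda>_. 0)" "\<sigma> 14 = array k cheaper" "\<sigma> 15 = array (Suc k) (\<lambda>_. 1)" "\<forall>a>15. \<sigma> a = (\<lambda>_. 0)"
    and vars: "\<sigma> 8 0 = int k + 1" "\<sigma> 10 0 = second_stage k" "\<sigma> 11 0 = first_stage k"
  shows "runs N \<sigma> select_cheaper (\<lambda>\<tau>. costs_computed (Suc k) \<tau> \<and> \<tau> 8 0 = int k + 1)"
proof -
  have second: "second_stage k = partial_row k n"
    by (simp add: second_stage_def partial_row_def)
  have small: "\<bar>first_stage k\<bar> \<le> 2 ^ (2 * N)" "\<bar>second_stage k\<bar> \<le> 2 ^ (3 * N)"
    using product_bound(1)[OF D, of 1] partial_row_bound[OF D, of n k] second
    by (auto simp: first_stage_def scaled_value_def)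
  \<comment> \<open>The tested difference has the largest bound among all values of the
    reduction.\<close>
  have "(2 :: int) ^ (2 * N) + 2 ^ (3 * N) \<le> 2 ^ (3 * N) + 2 ^ (3 * N)"
    by (intro add_mono power_increasing) auto
  also have "\<dots> = 2 ^ (3 * N + 1)"
    by simp
  also have "\<dots> \<le> magnitude N"
    by (rule power_le_magnitude) simp
  finally have mag: "\<bar>first_stage k\<bar> \<le> magnitude N" "\<bar>second_stage k\<bar> \<le> magnitude N"
    "\<bar>second_stage k - first_stage k\<bar> \<le> magnitude N" "int k + 1 \<le> magnitude N"
    using small index_le_magnitude[of k] k size_bounds by auto
  show ?thesis
    unfolding select_cheaper_def
  proof (intro runs_IfPos runs_Seq runs_Store, goal_cases)
    case 6
    then have "chosen k = 1" "cheaper k = first_stage k"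
      using vars by (auto simp: chosen_def cheaper_def var_def)
    then show ?case
      using \<sigma> vars by (auto simp: costs_computed_def input_kept_store array_Suc[of _ chosen] array_Suc[of _ cheaper])
        (auto simp: store_def var_def)
  next
    case 9
    then have "chosen k = 0" "cheaper k = second_stage k"
      using vars by (auto simp: chosen_def cheaper_def var_def)
    then show ?case
      using \<sigma> vars by (auto simp: costs_computed_def input_kept_store array_Suc_zero[of chosen] array_Suc[of _ cheaper])
        (auto simp: store_def var_def)
  qed (use mag vars magnitude_ge[of N] in \<open>auto simp: var_def store_def\<close>)
qed

lemma runs_compute_costs:
  assumes D: "common_denominator \<le> 2 ^ N"
    and \<sigma>: "input_kept \<sigma>" "\<forall>a>8. \<sigma> a = (\<lambda>_. 0)" "\<sigma> 7 0 = common_denominator"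
    and Q: "\<And>\<tau>. costs_computed n \<tau> \<Longrightarrow> Q \<tau>"
  shows "runs N \<sigma> compute_costs Q"
  unfolding compute_costs_def
proof (rule runs_for_loop[where m = n and Inv = costs_computed], goal_cases)
  case (1 k \<tau>)
  have k: "int k + 1 \<le> magnitude N"
    using index_le_magnitude[of k] 1 size_bounds by simp
  have fits: "fits N \<upsilon> (scaled a (var 8)) \<and> val \<upsilon> (scaled a (var 8)) = scaled_value a k"
    if "costs_computed k \<upsilon>" "\<upsilon> 8 0 = int k + 1" "odd a" "a < 7" for \<upsilon> a
    using that k magnitude_ge[of N]
    by (auto simp: costs_computed_def var_def intro!: fits_scaled[OF D] val_scaled)
  show ?case
    unfolding assign_def
  proof (intro runs_Seq runs_Store)
    let ?\<tau> = "store \<tau> 10 (val \<tau> (Const 0)) (val \<tau> (scaled 3 (var 8)))"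
    show "runs N ?\<tau> add_row (\<lambda>\<tau>. runs N \<tau>
      (Seq (Store 11 (Const 0) (scaled 1 (var 8))) (Seq (Store 15 (var 8) (Const 1)) select_cheaper))
      (\<lambda>\<upsilon>. costs_computed (Suc k) \<upsilon> \<and> \<upsilon> 8 0 = int k + 1))"
    proof (rule runs_add_row[OF D])
      fix \<upsilon>
      assume \<upsilon>: "costs_computed k \<upsilon>" "\<upsilon> 8 0 = int k + 1" "\<upsilon> 10 0 = second_stage k"
      show "runs N \<upsilon>
        (Seq (Store 11 (Const 0) (scaled 1 (var 8))) (Seq (Store 15 (var 8) (Const 1)) select_cheaper))
        (\<lambda>\<upsilon>. costs_computed (Suc k) \<upsilon> \<and> \<upsilon> 8 0 = int k + 1)"
      proof (intro runs_Seq runs_Store, goal_cases)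
        case 5
        show ?case
          using D 1(1)
        proof (rule runs_select_cheaper)
        qed (use \<upsilon> fits[OF \<upsilon>(1,2), of 1] in
            \<open>auto simp: costs_computed_def input_kept_store first_stage_def array_Suc, auto simp: store_def var_def\<close>)
      qed (use \<upsilon> fits[OF \<upsilon>(1,2), of 1] k magnitude_ge[of N] in \<open>auto simp: store_def var_def\<close>)
    qed (use 1 fits[of \<tau> 3] in \<open>auto simp: costs_computed_store, auto simp: store_def\<close>)
  qed (use 1 fits[of \<tau> 3] magnitude_ge[of N] in auto)
next
  case (3 k \<tau>)
  then show ?case
    using length_vector[of 1] by (simp add: costs_computed_def input_keptD)
qed (use \<sigma> Q size_bounds in \<open>auto simp: costs_computed_store, auto simp: costs_computed_def array_0\<close>)

lemma runs_copy_description: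
  assumes \<sigma>: "costs_computed n \<sigma>"
  shows "runs N \<sigma> (for_loop 8 0 (Store 13 (var 8) (Read 0 (var 8)))) (\<lambda>\<tau>. input_kept \<tau> \<and>
    \<tau> 12 = array n chosen \<and> \<tau> 13 = array L (\<lambda>k. \<sigma>0 0 (int k + 1)) \<and>
    \<tau> 14 = array n cheaper \<and> \<tau> 15 = array n (\<lambda>_. 1) \<and> (\<forall>a>15. \<tau> a = (\<lambda>_. 0)))"
proof (rule runs_for_loop[where m = L and Inv = "\<lambda>k \<tau>. input_kept \<tau> \<and>
    \<tau> 12 = array n chosen \<and> \<tau> 13 = array k (\<lambda>k. \<sigma>0 0 (int k + 1)) \<and>
    \<tau> 14 = array n cheaper \<and> \<tau> 15 = array n (\<lambda>_. 1) \<and> (\<forall>a>15. \<tau> a = (\<lambda>_. 0))"], goal_cases)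
  case (1 k \<tau>)
  then have eq: "\<tau> 0 = \<sigma>0 0"
    by (simp add: input_keptD)
  have k: "int k + 1 \<le> magnitude N"
    using index_le_magnitude[of k] 1 size_bounds by simp
  show ?case
  proof (rule runs_Store, goal_cases)
    case 3
    show ?case
      using 1 eq by (simp add: input_kept_store array_Suc[of k]) (simp add: store_def var_def)
  qed (use 1 eq k magnitude_ge[of N] cell_le_magnitude in \<open>simp_all add: var_def\<close>)
next
  case (2 k \<tau> x)
  then show ?case
    by (simp add: input_kept_store) (simp add: store_def)
next
  case (3 k \<tau>)
  then show ?case
    by (simp add: input_keptD length_description)
next
  case 6
  show ?case
    using \<sigma> by (simp add: costs_computed_def array_0)
qed (use size_bounds in simp_all)

lemma runs_prepare:
  assumes D: "common_denominator \<le> 2 ^ N"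
  shows "runs N \<sigma>0 prepare (\<lambda>\<tau>. input_kept \<tau> \<and> \<tau> 12 = array n chosen \<and> \<tau> 13 = \<sigma>0 0 \<and>
    \<tau> 14 = (array n cheaper)(0 := int n) \<and> \<tau> 15 = (array n (\<lambda>_. 1))(0 := int n) \<and>
    (\<forall>a>15. \<tau> a = (\<lambda>_. 0)))"
proof -
  \<comment> \<open>The products after the first and the second pass. The remaining factors are at
    least 1, so both inherit the bound on the final product.\<close>
  define p q where "p = denominators 2 n" and "q = p * denominators 4 n"
  have ge_1: "1 \<le> p" "1 \<le> denominators 4 n" "1 \<le> denominators 6 (n * n)"
    unfolding p_def using denominators_ge_1 length_vector length_matrix by simp_all
  have le: "q * denominators 6 (n * n) \<le> 2 ^ N"
    using D by (simp add: common_denominator_def p_def q_def)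
  have "p * 1 \<le> q"
    unfolding q_def using ge_1 by (intro mult_left_mono) auto
  with ge_1 have q: "1 \<le> q"
    by simp
  then have "q * 1 \<le> q * denominators 6 (n * n)"
    using ge_1 by (intro mult_left_mono) auto
  with le have le2: "q \<le> 2 ^ N"
    by simp
  with \<open>p * 1 \<le> q\<close> have le1: "p \<le> 2 ^ N"
    by simp
  \<comment> \<open>The loop copies entries only. With the length added, the copy equals its source
    everywhere, as the source is 0 outside its range.\<close>
  have description: "(array L (\<lambda>k. \<sigma>0 0 (int k + 1)))(0 := int L) = \<sigma>0 0"
    using description_outside length_description by (auto simp: array_def fun_eq_iff)
  have lengths: "int n \<le> magnitude N" "int L \<le> magnitude N"
    using le_magnitude[of n N] le_magnitude[of L N] size_bounds by auto
  have one: "multiplied 1 (store \<sigma>0 7 0 1)"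
    using unused by (simp add: multiplied_def input_kept_store) (simp add: store_def input_kept_def)
  have one_run: "runs N \<sigma>0 (assign 7 (Const 1)) (multiplied 1)"
    unfolding assign_def by (rule runs_Store) (use one magnitude_ge[of N] in simp_all)
  have two_run: "runs N \<sigma> (multiply_denominators 2) (multiplied p)" if "multiplied 1 \<sigma>" for \<sigma>
    using runs_multiply_denominators[OF that, of 2 n] le1 length_vector size_bounds
    by (simp add: p_def)
  have four_run: "runs N \<sigma> (multiply_denominators 4) (multiplied q)" if "multiplied p \<sigma>" for \<sigma>
    using runs_multiply_denominators[OF that, of 4 n] ge_1 le2 length_vector size_bounds
    by (simp add: q_def)
  have six_run: "runs N \<sigma> (multiply_denominators 6) (multiplied common_denominator)"
    if "multiplied q \<sigma>" for \<sigma>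
    using runs_multiply_denominators[OF that, of 6 "n * n"] q le length_matrix size_bounds
    by (simp add: common_denominator_def q_def p_def)
  have costs_run: "runs N \<sigma> compute_costs (costs_computed n)"
    if "multiplied common_denominator \<sigma>" for \<sigma>
    using runs_compute_costs[OF D, of \<sigma>] that by (simp add: multiplied_def)
  have lengths_run: "runs N \<sigma> (Seq (assign 13 (var 0)) (Seq (assign 14 (var 1)) (assign 15 (var 1))))
     (\<lambda>\<tau>. input_kept \<tau> \<and> \<tau> 12 = array n chosen \<and> \<tau> 13 = \<sigma>0 0 \<and>
    \<tau> 14 = (array n cheaper)(0 := int n) \<and> \<tau> 15 = (array n (\<lambda>_. 1))(0 := int n) \<and>
    (\<forall>a>15. \<tau> a = (\<lambda>_. 0)))"
    if \<sigma>: "input_kept \<sigma> \<and>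
      \<sigma> 12 = array n chosen \<and> \<sigma> 13 = array L (\<lambda>k. \<sigma>0 0 (int k + 1)) \<and>
      \<sigma> 14 = array n cheaper \<and> \<sigma> 15 = array n (\<lambda>_. 1) \<and> (\<forall>a>15. \<sigma> a = (\<lambda>_. 0))" for \<sigma>
  proof -
    have eq: "\<sigma> 0 0 = int L" "\<sigma> (Suc 0) 0 = int n"
      using \<sigma> length_description length_vector[of 1] by (simp_all add: input_keptD)
    show ?thesis
      unfolding assign_def
    proof (rule runs_Seq, rule runs_Store, goal_cases)
      case 3
      show ?case
      proof (rule runs_Seq, rule runs_Store, goal_cases)
        case 3
        show ?case
        proof (rule runs_Store, goal_cases)
          case 3
          show ?case
            using \<sigma> eq by (simp add: input_kept_store) (simp add: store_def var_def description)
        qed (use eq lengths magnitude_ge[of N] in \<open>simp_all add: var_def store_def\<close>)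
      qed (use eq lengths magnitude_ge[of N] in \<open>simp_all add: var_def store_def\<close>)
    qed (use eq lengths magnitude_ge[of N] in \<open>simp_all add: var_def store_def\<close>)
  qed
  show ?thesis
    unfolding prepare_def
    by (rule runs_Seq_post[OF one_run], erule runs_Seq_post[OF two_run],
        erule runs_Seq_post[OF four_run], erule runs_Seq_post[OF six_run],
        erule runs_Seq_post[OF costs_run], erule runs_Seq_post[OF runs_copy_description],
        erule lengths_run)
qed

end

section \<open>Reading off the two-stage solution\<close>

lemma runs_split_solution:
  assumes n: "n \<le> N" and \<sigma>: "\<forall>a\<in>{1, 2, 3, 4}. \<sigma> a 0 = int n"
    and f: "\<forall>k<n. \<sigma> 12 (int k + 1) = f k \<and> f k \<in> {0, 1}"
    and z: "\<forall>k<n. \<sigma> 14 (int k + 1) = z k \<and> z k \<in> {0, 1}"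
    and Q: "\<And>\<tau>. \<forall>a\<in>{1, 2, 3, 4}. \<tau> a 0 = int n \<Longrightarrow>
      \<forall>k<n. \<tau> 1 (int k + 1) = f k * z k \<and> \<tau> 2 (int k + 1) = 1 \<and>
        \<tau> 3 (int k + 1) = (1 - f k) * z k \<and> \<tau> 4 (int k + 1) = 1 \<Longrightarrow> Q \<tau>"
  shows "runs N \<sigma> split_solution Q"
  unfolding split_solution_def
proof (rule runs_for_loop[where m = n and Inv = "\<lambda>k \<tau>. (\<forall>a\<in>{1, 2, 3, 4}. \<tau> a 0 = int n) \<and>
      \<tau> 12 = \<sigma> 12 \<and> \<tau> 14 = \<sigma> 14 \<and>
      (\<forall>i<k. \<tau> 1 (int i + 1) = f i * z i \<and> \<tau> 2 (int i + 1) = 1 \<and>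
        \<tau> 3 (int i + 1) = (1 - f i) * z i \<and> \<tau> 4 (int i + 1) = 1)"], goal_cases)
  case (1 k \<tau>)
  note \<tau> = this
  have fz: "\<sigma> 12 (int k + 1) = f k" "\<sigma> 14 (int k + 1) = z k" "f k \<in> {0, 1}" "z k \<in> {0, 1}"
    using f z \<tau>(1) by auto
  have mag: "1 \<le> magnitude N" "int k + 1 \<le> magnitude N"
    using le_magnitude[of 0 N] le_magnitude[of k N] \<tau>(1) n by auto
  show ?case
    by (intro runs_Seq runs_Store)
      (use \<tau> fz mag in \<open>auto simp: store_def var_def less_Suc_eq\<close>)
next
  case (7 \<tau>)
  show ?case
    by (rule Q) (use 7 in simp_all)
qed (use n \<sigma> in \<open>auto simp: store_def\<close>)

lemma runs_unpack_solution:
  assumes n: "n \<le> N" and \<sigma>: "\<forall>a\<in>{1, 2, 3, 4}. \<sigma> a 0 = int n" "\<sigma> 13 1 = 1"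
    and f: "\<forall>k<n. \<sigma> 12 (int k + 1) = f k \<and> f k \<in> {0, 1}"
    and z: "\<forall>k<n. \<sigma> 14 (int k + 1) = z k \<and> z k \<in> {0, 1}"
  shows "runs N \<sigma> unpack (\<lambda>\<tau>. \<tau> 0 0 = 1 \<and> \<tau> 0 1 = 1 \<and> (\<forall>a\<in>{1, 2, 3, 4}. \<tau> a 0 = int n) \<and>
      (\<forall>k<n. \<tau> 1 (int k + 1) = f k * z k \<and> \<tau> 2 (int k + 1) = 1 \<and>
        \<tau> 3 (int k + 1) = (1 - f k) * z k \<and> \<tau> 4 (int k + 1) = 1))"
  unfolding unpack_def
proof (rule runs_IfPos, goal_cases)
  case 2
  show ?case
    by (rule runs_Seq, rule runs_split_solution[OF n \<sigma>(1) f z], unfold assign_def,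
        rule runs_Seq, rule runs_Store, simp_all add: store_def magnitude_ge,
        rule runs_Store) (simp_all add: store_def magnitude_ge)
qed (use \<sigma> magnitude_ge in auto)

lemma runs_unpack_infeasible:
  assumes "\<sigma> 13 1 = 0"
  shows "runs N \<sigma> unpack (\<lambda>\<tau>. \<tau> 0 0 = 1 \<and> \<tau> 0 1 = 0)"
  unfolding unpack_def
proof (rule runs_IfPos, goal_cases)
  case 3
  show ?case
    unfolding assign_def
    by (rule runs_Seq, rule runs_Store, simp_all add: store_def magnitude_ge,
        rule runs_Store) (simp_all add: store_def magnitude_ge)
qed (use assms magnitude_ge in auto)


section \<open>Encoded instances\<close>

lemma init_state_nth:
  assumes "a < length xss"
  shows "init_state xss a 0 = int (length (xss ! a))"
    "k < length (xss ! a) \<Longrightarrow> init_state xss a (int k + 1) = xss ! a ! k"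
  using assms by (simp_all add: init_state_def nat_add_distrib)

lemma init_state_array:
  assumes "a < length xss"
  shows "init_state xss a =
    (array (length (xss ! a)) (\<lambda>k. xss ! a ! k))(0 := int (length (xss ! a)))"
proof
  fix i :: int
  consider "i < 0" | "i = 0" | "0 < i"
    by linarith
  then show "init_state xss a i =
      ((array (length (xss ! a)) (\<lambda>k. xss ! a ! k))(0 := int (length (xss ! a)))) i"
    using assms by cases (simp_all add: init_state_def array_def nth_Cons')
qed

lemma array_cong: "(\<And>k. k < n \<Longrightarrow> f k = g k) \<Longrightarrow> array n f = array n g"
  by (auto simp: array_def fun_eq_iff)

lemma bit_size_ge_1: "1 \<le> bit_size k"
  by (simp add: bit_size_def)

lemma length_le_bit_sizes: "length xs \<le> (\<Sum>k\<leftarrow>xs. bit_size k)"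
proof (induction xs)
  case (Cons k xs)
  then show ?case using bit_size_ge_1[of k] by simp
qed simp

lemma input_size_nth: "a < length xss \<Longrightarrow> 1 + (\<Sum>k\<leftarrow>xss ! a. bit_size k) \<le> input_size xss"
  unfolding input_size_def by (intro member_le_sum_list) auto

text \<open>An entry is bounded through its own bit size, a length because each entry contributes at
  least 1 to the input size.\<close>

lemma init_state_bound: "\<bar>init_state xss a i\<bar> \<le> 2 ^ input_size xss"
proof (cases "a < length xss \<and> 0 \<le> i \<and> i \<le> int (length (xss ! a))")
  case True
  show ?thesis
  proof (cases "i = 0")
    case i: True
    have "length (xss ! a) \<le> input_size xss"
      using length_le_bit_sizes[of "xss ! a"] input_size_nth[of a xss] True by simp
    then have "length (xss ! a) \<le> 2 ^ input_size xss"
      by (meson less_exp less_imp_le order_trans)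
    then have "int (length (xss ! a)) \<le> int (2 ^ input_size xss)"
      by (simp only: of_nat_le_iff)
    then show ?thesis
      using True i by (simp add: init_state_def)
  next
    case False
    define k where "k = nat i - 1"
    have k: "i = int k + 1" "k < length (xss ! a)"
      using True False by (auto simp: k_def)
    then have eq: "init_state xss a i = xss ! a ! k"
      using init_state_nth True by simp
    have "bit_size (xss ! a ! k) \<le> (\<Sum>k\<leftarrow>xss ! a. bit_size k)"
      using k by (intro member_le_sum_list) auto
    also have "\<dots> \<le> input_size xss"
      using input_size_nth[of a xss] True by simp
    finally have "(2 :: int) ^ bit_size (xss ! a ! k) \<le> 2 ^ input_size xss"
      by (intro power_increasing) auto
    from order_trans[OF abs_le_bit_size this] show ?thesis
      unfolding eq .
  qed
next
  case False
  then have "init_state xss a i = 0"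
    unfolding init_state_def by (rule if_not_P)
  then show ?thesis
    by simp
qed

lemma concat_map_upt_nth:
  "i < m \<Longrightarrow> j < n \<Longrightarrow> concat (map (\<lambda>i. map (f i) [0..<n]) [0..<m]) ! (i * n + j) = f i j"
proof (induction m)
  case (Suc m)
  have length: "length (concat (map (\<lambda>i. map (f i) [0..<n]) [0..<m])) = m * n"
    by (simp add: length_concat comp_def sum_list_triv)
  show ?case
  proof (cases "i = m")
    case True
    then show ?thesis
      using Suc.prems length by (simp add: nth_append)
  next
    case False
    then have "i < m"
      using Suc.prems by simp
    have "i * n + j < Suc i * n"
      using Suc.prems by simp
    also have "\<dots> \<le> m * n"
      using \<open>i < m\<close> by (intro mult_le_mono1) simp
    finally show ?thesis
      using Suc.IH \<open>i < m\<close> Suc.prems length by (simp add: nth_append)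
  qed
qed simp

lemma rat_times_denominator:
  assumes "snd (quotient_of q) dvd s"
  shows "real_of_int (fst (quotient_of q) * (s div snd (quotient_of q))) = real_of_int s * real_of_rat q"
proof -
  obtain a b where ab: "quotient_of q = (a, b)"
    by fastforce
  have "b \<noteq> 0"
    using quotient_of_denom_pos[OF ab] by simp
  moreover have "real_of_rat q = real_of_int a / real_of_int b"
    using quotient_of_div[OF ab] by (simp add: of_rat_divide)
  ultimately show ?thesis
    using assms ab by (simp add: real_of_int_div)
qed

locale two_stage_input =
  fixes n :: nat and d :: "int list" and C c :: "rat vec" and A :: "rat mat"
  assumes carrier: "C \<in> carrier_vec n" "c \<in> carrier_vec n" "A \<in> carrier_mat n n"
begin

abbreviation input :: "int list list" where
  "input \<equiv> enc_two_stage (d, C, c, A)"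

text \<open>The rationals whose numerators are in array \<open>a\<close> and whose denominators are in array \<open>a + 1\<close>.\<close>

definition rationals :: "nat \<Rightarrow> rat list" where
  "rationals a = (if a = 1 then list_of_vec C else if a = 3 then list_of_vec c else concat (mat_to_list A))"

lemma input_eq: "input = [d,
    map (fst \<circ> quotient_of) (rationals 1), map (snd \<circ> quotient_of) (rationals 1),
    map (fst \<circ> quotient_of) (rationals 3), map (snd \<circ> quotient_of) (rationals 3),
    map (fst \<circ> quotient_of) (rationals 5), map (snd \<circ> quotient_of) (rationals 5)]"
  by (simp add: enc_two_stage_def enc_vec_def enc_mat_def enc_rats_def rationals_def)

lemma length_rationals: "length (rationals 1) = n" "length (rationals 3) = n" "length (rationals 5) = n * n"
  using carrier by (simp_all add: rationals_def mat_to_list_def length_concat comp_def sum_list_triv)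

lemma input_nth:
  "length input = 7" "input ! 0 = d"
  "a \<in> {1, 3, 5} \<Longrightarrow> input ! a = map (fst \<circ> quotient_of) (rationals a)"
  "a \<in> {1, 3, 5} \<Longrightarrow> input ! Suc a = map (snd \<circ> quotient_of) (rationals a)"
  unfolding input_eq by auto

lemma denominator_arrays: "a \<in> {2, 4, 6} \<Longrightarrow> \<exists>b\<in>{1, 3, 5}. a = Suc b"
  by auto

text \<open>The size parameter is the input size of the instance itself, so every bound becomes one
  in the input size. That it dominates n * n is due to the n * n matrix entries in the
  input.\<close>

sublocale two_stage_memory "input_size input" n "length d" "init_state input"
proof
  show "\<bar>init_state input a i\<bar> \<le> 2 ^ input_size input" for a i
    by (rule init_state_bound)
  have den: "0 < init_state input a (int k + 1)"
    if "a \<in> {2, 4, 6}" "k < length (input ! a)" for a k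
  proof -
    obtain b where "b \<in> {1, 3, 5}" "a = Suc b"
      using denominator_arrays[OF \<open>a \<in> {2, 4, 6}\<close>] by blast
    then show ?thesis
      using that input_nth(1) init_state_nth(2)[of a input k] input_nth(4)[of b]
      by (auto simp: quotient_of_denom_pos')
  qed
  have len: "init_state input a 0 = int (length (input ! a))" if "a < 7" for a
    using that input_nth(1) by (simp add: init_state_nth)
  show "0 < init_state input a (int k + 1)" if "a \<in> {2, 4, 6}" "int k < init_state input a 0" for a k
    using that len[of a] den by auto
  show "0 \<le> init_state input a i" if "a \<in> {2, 4, 6}" for a i
  proof (cases "1 \<le> i \<and> i \<le> int (length (input ! a))")
    case True
    define k where "k = nat i - 1"
    have "i = int k + 1" "k < length (input ! a)"
      using True by (auto simp: k_def)
    then show ?thesis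
      using den[OF that, of k] by simp
  next
    case False
    moreover have "a < 7"
      using that by auto
    ultimately show ?thesis
      using init_state_array[of a input] input_nth(1) by (auto simp: array_def)
  qed
  show "init_state input 0 0 = int (length d)"
    using len[of 0] input_nth(2) by simp
  show "init_state input a 0 = int n" if "a \<in> {1, 2, 3, 4}" for a
    using that len[of a] length_rationals by (auto simp: input_eq)
  show "init_state input 6 0 = int (n * n)"
    using len[of 6] length_rationals by (auto simp: input_eq)
  have size: "length (input ! a) \<le> input_size input" if "a < 7" for a
    using that input_nth(1) input_size_nth[of a input] length_le_bit_sizes[of "input ! a"] by simp
  show "length d \<le> input_size input"
    using size[of 0] input_nth(2) by simp
  show "n \<le> input_size input"
    using size[of 1] input_nth(3)[of 1] length_rationals by simp
  show "n * n \<le> input_size input"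
    using size[of 5] input_nth(3)[of 5] length_rationals by simp
  show "init_state input 0 i = 0" if "i < 0 \<or> i > int (length d)" for i
    using that input_nth(2) by (auto simp: init_state_def)
  show "init_state input a = (\<lambda>_. 0)" if "a \<ge> 7" for a
    using that input_nth(1) by (auto simp: init_state_def)
qed

lemma denominators_eq:
  assumes "a \<in> {1, 3, 5}"
  shows "denominators (Suc a) (length (rationals a)) = (\<Prod>k<length (rationals a). snd (quotient_of (rationals a ! k)))"
proof -
  have "Suc a < length input"
    using assms input_nth(1) by auto
  then show ?thesis
    unfolding denominators_def
    using input_nth(4)[OF assms] by (intro prod.cong) (auto simp: init_state_nth)
qed

text \<open>Each denominator is at most 2 to the power of its bit size, and the exponents add up in
  the product.\<close>

lemma denominators_le:
  assumes "a \<in> {1, 3, 5}"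
  shows "denominators (Suc a) (length (rationals a)) \<le> 2 ^ (\<Sum>k\<leftarrow>input ! Suc a. bit_size k)"
proof -
  have "denominators (Suc a) (length (rationals a))
      \<le> (\<Prod>k<length (rationals a). 2 ^ bit_size (snd (quotient_of (rationals a ! k))))"
    unfolding denominators_eq[OF assms]
    using quotient_of_denom_pos' abs_le_bit_size by (intro prod_mono) (auto simp: less_imp_le abs_le_iff)
  also have "\<dots> = 2 ^ (\<Sum>k<length (rationals a). bit_size (snd (quotient_of (rationals a ! k))))"
    by (simp add: power_sum)
  also have "(\<Sum>k<length (rationals a). bit_size (snd (quotient_of (rationals a ! k))))
      = (\<Sum>k\<leftarrow>input ! Suc a. bit_size k)"
    unfolding input_nth(4)[OF assms] by (simp add: sum_list_sum_nth atLeast0LessThan)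
  finally show ?thesis .
qed

text \<open>The three denominator arrays are separate parts of the input, so their bit sizes
  together stay within the input size.\<close>

lemma common_denominator_le: "common_denominator \<le> 2 ^ input_size input"
proof -
  define l where "l a = (\<Sum>k\<leftarrow>input ! a. bit_size k)" for a
  have D: "denominators 2 n \<le> 2 ^ l 2" "denominators 4 n \<le> 2 ^ l 4" "denominators 6 (n * n) \<le> 2 ^ l 6"
    using denominators_le[of 1] denominators_le[of 3] denominators_le[of 5] length_rationals
    by (simp_all add: l_def numeral_eq_Suc)
  have pos: "0 \<le> denominators 4 n" "0 \<le> denominators 6 (n * n)"
    using denominators_ge_1[of 4 n] denominators_ge_1[of 6 "n * n"] length_vector[of 4] length_matrix by auto
  have "common_denominator \<le> 2 ^ l 2 * 2 ^ l 4 * 2 ^ l 6"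
    unfolding common_denominator_def using D pos by (intro mult_mono) auto
  also have "\<dots> = 2 ^ (l 2 + l 4 + l 6)"
    by (simp add: power_add)
  also have "\<dots> \<le> 2 ^ input_size input"
    by (intro power_increasing) (simp_all add: input_size_def l_def input_eq)
  finally show ?thesis .
qed

lemma denominator_dvd:
  assumes "a \<in> {1, 3, 5}" "k < length (rationals a)"
  shows "snd (quotient_of (rationals a ! k)) dvd common_denominator"
proof -
  have "snd (quotient_of (rationals a ! k)) dvd denominators (Suc a) (length (rationals a))"
    unfolding denominators_eq[OF assms(1)] using assms(2)
    by (intro dvd_prodI[of _ _ "\<lambda>k. snd (quotient_of (rationals a ! k))"]) auto
  also have "\<dots> dvd common_denominator"
    unfolding common_denominator_def using assms(1) length_rationals
    by (auto simp: numeral_eq_Suc intro: dvd_mult dvd_mult2)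
  finally show ?thesis .
qed

lemma scaled_value_eq:
  assumes "a \<in> {1, 3, 5}" "k < length (rationals a)"
  shows "real_of_int (scaled_value a k) = real_of_int common_denominator * real_of_rat (rationals a ! k)"
proof -
  have "a < length input" "Suc a < length input"
    using assms(1) input_nth(1) by auto
  then have "scaled_value a k = fst (quotient_of (rationals a ! k)) *
      (common_denominator div snd (quotient_of (rationals a ! k)))"
    using assms input_nth(3,4)[of a] by (simp add: scaled_value_def init_state_nth)
  then show ?thesis
    using rat_times_denominator[OF denominator_dvd[OF assms]] by simp
qed

lemma first_stage_eq:
  "k < n \<Longrightarrow> real_of_int (first_stage k) = real_of_int common_denominator * real_vec C $ k"
  using scaled_value_eq[of 1 k] length_rationals carrier
  by (simp add: first_stage_def) (simp add: rationals_def)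

lemma second_stage_eq:
  assumes k: "k < n"
  shows "real_of_int (second_stage k) =
    real_of_int common_denominator * item_cost (real_vec c) (real_mat A) k"
proof -
  have A: "rationals 5 ! (k * n + j) = A $$ (k, j)" if "j < n" for j
    using concat_map_upt_nth[OF k that, of "\<lambda>i j. A $$ (i, j)"] carrier(3)
    by (simp add: rationals_def mat_to_list_def)
  have index: "k * n + j < n * n" if "j < n" for j
  proof -
    have "k * n + j < Suc k * n"
      using that by simp
    also have "\<dots> \<le> n * n"
      using k by (intro mult_le_mono1) simp
    finally show ?thesis .
  qed
  have "real_of_int (second_stage k) = real_of_int (scaled_value 3 k) +
      (\<Sum>j<n. real_of_int (scaled_value 5 (k * n + j)))"
    by (simp add: second_stage_def)
  also have "real_of_int (scaled_value 3 k) = real_of_int common_denominator * real_vec c $ k"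
    using scaled_value_eq[of 3 k] length_rationals(2) carrier k by simp (simp add: rationals_def)
  also have "(\<Sum>j<n. real_of_int (scaled_value 5 (k * n + j))) =
      (\<Sum>j<n. real_of_int common_denominator * real_mat A $$ (k, j))"
    using scaled_value_eq[of 5] A index length_rationals(3) carrier k by (intro sum.cong) auto
  finally show ?thesis
    using carrier by (simp add: item_cost_def distrib_left sum_distrib_left)
qed

definition deterministic_costs :: "rat vec" where
  "deterministic_costs = vec n (\<lambda>k. of_int (cheaper k))"

lemma real_deterministic_costs:
  assumes "k < n"
  shows "real_vec deterministic_costs $ k =
    real_of_int common_denominator * min (real_vec C $ k) (item_cost (real_vec c) (real_mat A) k)"
proof -
  have "real_vec deterministic_costs $ k = min (real_of_int (first_stage k)) (real_of_int (second_stage k))"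
    using assms by (simp add: deterministic_costs_def cheaper_def min_def)
  also have "\<dots> = real_of_int common_denominator * min (real_vec C $ k) (item_cost (real_vec c) (real_mat A) k)"
    unfolding first_stage_eq[OF assms] second_stage_eq[OF assms]
    using common_denominator_ge_1 by (simp add: min_mult_distrib_left)
  finally show ?thesis .
qed

lemma chosen_eq:
  assumes "k < n"
  shows "chosen k = (if real_vec C $ k < item_cost (real_vec c) (real_mat A) k then 1 else 0)"
proof -
  have "first_stage k < second_stage k \<longleftrightarrow> real_of_int (first_stage k) < real_of_int (second_stage k)"
    by simp
  also have "\<dots> \<longleftrightarrow> real_vec C $ k < item_cost (real_vec c) (real_mat A) k"
    unfolding first_stage_eq[OF assms] second_stage_eq[OF assms]
    using common_denominator_ge_1 by simp
  finally show ?thesis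
    by (simp add: chosen_def)
qed

lemma enc_deterministic_costs:
  "enc_deterministic (d, deterministic_costs) = [d, map cheaper [0..<n], map (\<lambda>_. 1) [0..<n]]"
  by (simp add: enc_deterministic_def enc_vec_def enc_rats_def deterministic_costs_def)

text \<open>The description takes at most N, the 2 counts the two further lists, and each of these
  has n \<le> N entries of at most \<open>word_length N\<close> bits. The solver's time is
  polynomial in this size, hence in N.\<close>

lemma input_size_deterministic_costs:
  defines "N \<equiv> input_size input"
  shows "input_size (enc_deterministic (d, deterministic_costs)) \<le> N + 2 + 2 * (N * word_length N)"
proof -
  have cheaper: "bit_size (cheaper k) \<le> word_length N" for k
  proof (rule bit_size_magnitude)
    have "\<bar>first_stage k\<bar> \<le> 2 ^ (2 * N)"
      using scaled_value_bound[OF common_denominator_le, of 1] by (simp add: first_stage_def N_def)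
    then have "\<bar>first_stage k\<bar> \<le> magnitude N"
      using power_le_magnitude[of "2 * N" N] by simp
    moreover have "\<bar>second_stage k\<bar> \<le> magnitude N"
      using partial_row_magnitude[OF common_denominator_le, of n k]
      by (simp add: second_stage_def partial_row_def N_def)
    ultimately show "\<bar>cheaper k\<bar> \<le> magnitude N"
      by (simp add: cheaper_def min_def)
  qed
  have one: "bit_size 1 \<le> word_length N"
    by (rule bit_size_magnitude) (use magnitude_ge in simp)
  have "(\<Sum>k\<leftarrow>map cheaper [0..<n]. bit_size k) \<le> (\<Sum>k\<leftarrow>[0..<n]. word_length N)"
    unfolding map_map comp_def using cheaper by (intro sum_list_mono)
  moreover have "(\<Sum>k\<leftarrow>map (\<lambda>_. 1) [0..<n]. bit_size k) \<le> (\<Sum>k\<leftarrow>[0..<n]. word_length N)"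
    unfolding map_map comp_def using one by (intro sum_list_mono)
  moreover have "(\<Sum>k\<leftarrow>[0..<n]. word_length N) \<le> N * word_length N"
    using mult_le_mono1[OF size_bounds(2), of "word_length N"] by (simp add: sum_list_triv N_def)
  moreover have "1 + (\<Sum>k\<leftarrow>d. bit_size k) \<le> N"
    using input_size_nth[of 0 input] input_nth(1,2) by (simp add: N_def)
  ultimately show ?thesis
    unfolding enc_deterministic_costs input_size_def by simp
qed

definition split_rat_vec :: "rat vec \<Rightarrow> rat vec \<times> rat vec" where
  "split_rat_vec z = (vec n (\<lambda>k. of_int (chosen k) * z $ k), vec n (\<lambda>k. of_int (1 - chosen k) * z $ k))"

text \<open>The integer comparison behind \<open>chosen\<close> is the real one multiplied by the
  positive common denominator, so the program realizes \<open>split_vec\<close>.\<close>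

lemma real_split_rat_vec:
  assumes "z \<in> carrier_vec n"
  shows "map_prod real_vec real_vec (split_rat_vec z) =
    split_vec (real_vec C) (real_vec c) (real_mat A) (real_vec z)"
  using assms chosen_eq by (auto simp: split_rat_vec_def split_vec_def)

text \<open>The equation for \<open>\<tau>\<close> says that from array 13 on the memory looks like
  a fresh start on the deterministic instance, with the lower arrays left as they are;
  \<open>exec_shift_com\<close> needs this form.\<close>

lemma runs_prepare_input:
  "runs (input_size input) (init_state input) prepare (\<lambda>\<tau>.
    \<tau> = overlay 13 (init_state (enc_deterministic (d, deterministic_costs))) \<tau> \<and>
    (\<forall>a\<in>{1, 2, 3, 4}. \<tau> a 0 = int n) \<and> \<tau> 12 = array n chosen)"
proof (rule runs_weaken[OF runs_prepare[OF common_denominator_le]], elim conjE, intro conjI)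
  let ?e = "enc_deterministic (d, deterministic_costs)"
  fix \<tau>
  assume \<tau>: "input_kept \<tau>" "\<tau> 13 = init_state input 0" "\<tau> 14 = (array n cheaper)(0 := int n)"
    "\<tau> 15 = (array n (\<lambda>_. 1))(0 := int n)" "\<forall>a>15. \<tau> a = (\<lambda>_. 0)"
  show "\<forall>a\<in>{1, 2, 3, 4}. \<tau> a 0 = int n"
    using length_vector input_keptD[OF \<tau>(1)] by auto
  have e: "init_state ?e 0 = init_state input 0"
    using init_state_array[of 0 ?e] init_state_array[of 0 input] input_nth(1,2)
    by (simp add: enc_deterministic_costs)
  have e1: "init_state ?e 1 = (array n cheaper)(0 := int n)"
    using init_state_array[of 1 ?e] array_cong[of n "(!) (map cheaper [0..<n])" cheaper]
    by (simp add: enc_deterministic_costs)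
  have e2: "init_state ?e 2 = (array n (\<lambda>_. 1))(0 := int n)"
    using init_state_array[of 2 ?e] array_cong[of n "(!) (map (\<lambda>_. 1) [0..<n])" "\<lambda>_. 1"]
    by (simp add: enc_deterministic_costs)
  have e3: "init_state ?e a = (\<lambda>_. 0)" if "a > 2" for a
    using that by (auto simp: init_state_def enc_deterministic_costs)
  show "\<tau> = overlay 13 (init_state ?e) \<tau>"
  proof
    fix a :: nat
    consider "a < 13" | "a = 13" | "a = 14" | "a = 15" | "a > 15"
      by linarith
    then show "\<tau> a = overlay 13 (init_state ?e) \<tau> a"
      using \<tau> e e1 e2 e3[of "a - 13"] by cases (simp_all add: overlay_def)
  qed
qed

end

section \<open>The complete program and its running time\<close>

definition two_stage_program :: "com \<Rightarrow> com" where
  "two_stage_program p = Seq prepare (Seq (shift_com 13 p) unpack)"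

context two_stage_input
begin

text \<open>Entries 0 and 1 have denominator 1 in reduced form, and so have their products with
  \<open>chosen k\<close>; multiplying numerators thus yields the reduced fractions that the
  encoding demands.\<close>

lemma holds_output_split:
  assumes z: "z \<in> carrier_vec n" "\<And>k. k < n \<Longrightarrow> z $ k \<in> {0, 1}"
    and \<tau>: "\<tau> 0 0 = 1 \<and> \<tau> 0 1 = 1 \<and> (\<forall>a\<in>{1, 2, 3, 4}. \<tau> a 0 = int n) \<and>
      (\<forall>k<n. \<tau> 1 (int k + 1) = chosen k * fst (quotient_of (z $ k)) \<and> \<tau> 2 (int k + 1) = 1 \<and>
        \<tau> 3 (int k + 1) = (1 - chosen k) * fst (quotient_of (z $ k)) \<and> \<tau> 4 (int k + 1) = 1)"
  shows "holds_output \<tau> (enc_answer (\<lambda>(x, y). enc_vec x @ enc_vec y) (Some (split_rat_vec z)))"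
proof -
  have q: "quotient_of (of_int (chosen k) * z $ k) = (chosen k * fst (quotient_of (z $ k)), 1)"
    "quotient_of (of_int (1 - chosen k) * z $ k) = ((1 - chosen k) * fst (quotient_of (z $ k)), 1)"
    if "k < n" for k
    using z(2)[OF that] by (auto simp: chosen_def)
  show ?thesis
    using \<tau> q
    by (simp add: holds_output_def enc_answer_def split_rat_vec_def enc_vec_def enc_rats_def
        All_less_Suc2 numeral_eq_Suc)
qed

text \<open>The relocated solver leaves the arrays below 13 alone, so the marks in array 12 and the
  length cells survive it. The summand 2 pays for the two sequential compositions.\<close>

lemma exec_two_stage_program:
  assumes p: "exec p (init_state (enc_deterministic (d, deterministic_costs))) t \<upsilon>"
    and \<upsilon>: "holds_output \<upsilon> (enc_answer enc_vec r)"
    and r: "\<And>z. r = Some z \<Longrightarrow> z \<in> carrier_vec n \<and> (\<forall>k<n. z $ k \<in> {0, 1})"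
  shows "\<exists>t' \<omega>. exec (two_stage_program p) (init_state input) t' \<omega> \<and>
    t' \<le> 2 + time_bound (input_size input) prepare + t + time_bound (input_size input) unpack \<and>
    holds_output \<omega> (enc_answer (\<lambda>(x, y). enc_vec x @ enc_vec y) (map_option split_rat_vec r))"
proof -
  obtain t1 \<tau> where prep: "exec prepare (init_state input) t1 \<tau>" "t1 \<le> time_bound (input_size input) prepare"
    and \<tau>: "\<tau> = overlay 13 (init_state (enc_deterministic (d, deterministic_costs))) \<tau>"
      "\<forall>a\<in>{1, 2, 3, 4}. \<tau> a 0 = int n" "\<tau> 12 = array n chosen"
    using runs_prepare_input unfolding runs_def by blast
  let ?\<sigma> = "overlay 13 \<upsilon> \<tau>"
  have solve: "exec (shift_com 13 p) \<tau> t ?\<sigma>"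
    using exec_shift_com[OF p, of 13 \<tau>] \<tau>(1) by simp
  have "runs (input_size input) ?\<sigma> unpack
    (\<lambda>\<omega>. holds_output \<omega> (enc_answer (\<lambda>(x, y). enc_vec x @ enc_vec y) (map_option split_rat_vec r)))"
  proof (cases r)
    case None
    then have "?\<sigma> 13 1 = 0"
      using \<upsilon> by (simp add: holds_output_def enc_answer_def overlay_def)
    from runs_unpack_infeasible[of ?\<sigma>, OF this] show ?thesis
      by (rule runs_weaken) (simp add: None holds_output_def enc_answer_def)
  next
    case (Some z)
    then have z: "z \<in> carrier_vec n" "\<And>k. k < n \<Longrightarrow> z $ k \<in> {0, 1}"
      using r by auto
    have out: "\<upsilon> 0 1 = 1" "\<And>k. k < n \<Longrightarrow> \<upsilon> 1 (int k + 1) = fst (quotient_of (z $ k))"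
      using \<upsilon> z(1) by (auto simp: Some holds_output_def enc_answer_def enc_vec_def enc_rats_def All_less_Suc2)
    have "fst (quotient_of (z $ k)) \<in> {0, 1}" if "k < n" for k
      using z(2)[OF that] by auto
    with out have "runs (input_size input) ?\<sigma> unpack (\<lambda>\<omega>. \<omega> 0 0 = 1 \<and> \<omega> 0 1 = 1 \<and>
      (\<forall>a\<in>{1, 2, 3, 4}. \<omega> a 0 = int n) \<and>
      (\<forall>k<n. \<omega> 1 (int k + 1) = chosen k * fst (quotient_of (z $ k)) \<and> \<omega> 2 (int k + 1) = 1 \<and>
        \<omega> 3 (int k + 1) = (1 - chosen k) * fst (quotient_of (z $ k)) \<and> \<omega> 4 (int k + 1) = 1))"
      using size_bounds(2) \<tau>(2,3)
      by (intro runs_unpack_solution) (simp_all add: overlay_def array_def chosen_def nat_add_distrib)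
    then show ?thesis
      unfolding Some option.map by (rule runs_weaken) (rule holds_output_split[OF z])
  qed
  then obtain t2 \<omega> where un: "exec unpack ?\<sigma> t2 \<omega>" "t2 \<le> time_bound (input_size input) unpack"
    "holds_output \<omega> (enc_answer (\<lambda>(x, y). enc_vec x @ enc_vec y) (map_option split_rat_vec r))"
    unfolding runs_def by blast
  show ?thesis
    unfolding two_stage_program_def
    using exec_Seq[OF prep(1) exec_Seq[OF solve un(1)]] prep(2) un(2,3)
    by (intro exI[of _ "1 + t1 + (1 + t + t2)"] exI[of _ \<omega>]) simp
qed

end

text \<open>The displacement 0 has norm at most 1. As all points of the ellipsoid are nonnegative in
  an instance, this yields nonnegative second-stage costs.\<close>

lemma center_in_ellipsoid:
  assumes "c \<in> carrier_vec n" "A \<in> carrier_mat n n"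
  shows "c \<in> ellipsoid c A"
proof -
  have "A *\<^sub>v 0\<^sub>v n = 0\<^sub>v n"
    using assms(2) by (intro eq_vecI) auto
  then have "c = c + A *\<^sub>v 0\<^sub>v n"
    using assms(1) by simp
  moreover have "norm2 (0\<^sub>v n) \<le> 1"
    by (simp add: norm2_def L2_set_def)
  ultimately show ?thesis
    using assms(2) unfolding ellipsoid_def by (intro CollectI exI[of _ "0\<^sub>v n"]) auto
qed

theorem theorem11:
  fixes D :: "int list set"
    and H :: "int list \<Rightarrow> real mat"
    and g :: "int list \<Rightarrow> real vec"
  assumes "\<And>d. d \<in> D \<Longrightarrow> g d \<in> carrier_vec (dim_row (H d))"
    and "\<And>d. d \<in> D \<Longrightarrow> integral_polyhedron (dim_col (H d)) (relaxation (H d) (g d))"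
    and "deterministic_poly_solvable D H g"
  shows "poly_time_search
    {(d, C, c, A) \<in> two_stage_instances D H. \<forall>i < dim_row A. \<forall>j < dim_col A. 0 \<le> A $$ (i, j)}
    enc_two_stage
    (\<lambda>(d, C, c, A) r. solves_within (sqrt (real (dim_col (H d))))
       (two_stage_feasible (H d) (g d))
       (two_stage_cost (real_vec C) (real_vec c) (real_mat A))
       (map_option (map_prod real_vec real_vec) r))
    (enc_answer (\<lambda>(x, y). enc_vec x @ enc_vec y))"
proof -
  obtain p and q :: "nat poly" where solver: "\<And>d C. (d, C) \<in> deterministic_instances D H \<Longrightarrow> \<exists>t \<tau> r.
      exec p (init_state (enc_deterministic (d, C))) t \<tau> \<and>
      t \<le> poly q (input_size (enc_deterministic (d, C))) \<and> holds_output \<tau> (enc_answer enc_vec r) \<and>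
      solves (binary_solutions (H d) (g d)) (\<lambda>x. real_vec C \<bullet> x) (map_option real_vec r)"
    using assms(3) unfolding deterministic_poly_solvable_def poly_time_search_def by fast
  \<comment> \<open>One polynomial must be fixed before any instance; the argument of
    \<open>q\<close> is the bound on the size of the deterministic instance.\<close>
  have "polynomial_fun (\<lambda>N. 2 + time_bound N prepare + poly q (N + 2 + 2 * (N * word_length N))
      + time_bound N unpack)"
    by (intro polynomial_fun_intros polynomial_fun_time_bound)
  then obtain Q :: "nat poly" where Q: "\<And>N. 2 + time_bound N prepare
      + poly q (N + 2 + 2 * (N * word_length N)) + time_bound N unpack = poly Q N"
    unfolding polynomial_fun_def by blast
  have "\<exists>t \<tau> r. exec (two_stage_program p) (init_state (enc_two_stage (d, C, c, A))) t \<tau> \<and>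
      t \<le> poly Q (input_size (enc_two_stage (d, C, c, A))) \<and>
      holds_output \<tau> (enc_answer (\<lambda>(x, y). enc_vec x @ enc_vec y) r) \<and>
      solves_within (sqrt (real (dim_col (H d)))) (two_stage_feasible (H d) (g d))
        (two_stage_cost (real_vec C) (real_vec c) (real_mat A)) (map_option (map_prod real_vec real_vec) r)"
    if inst: "(d, C, c, A) \<in> two_stage_instances D H"
      and A_nonneg: "\<forall>i < dim_row A. \<forall>j < dim_col A. 0 \<le> A $$ (i, j)" for d C c A
  proof -
    define n where "n = dim_col (H d)"
    have d: "d \<in> D" and C: "C \<in> carrier_vec n" "0\<^sub>v n \<le> C" and c: "c \<in> carrier_vec n"
      and A: "A \<in> carrier_mat n n" and ellipsoid: "\<forall>u \<in> ellipsoid (real_vec c) (real_mat A). 0\<^sub>v n \<le> u"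
      using inst by (auto simp: two_stage_instances_def n_def)
    interpret two_stage_input n d C c A
      by unfold_locales (use C c A in auto)
    have rC: "real_vec C \<in> carrier_vec n" "0\<^sub>v n \<le> real_vec C"
      using C by (auto simp: less_eq_vec_def)
    have rc: "real_vec c \<in> carrier_vec n" "0\<^sub>v n \<le> real_vec c"
      using center_in_ellipsoid[of "real_vec c" n "real_mat A"] c A ellipsoid by auto
    have rA: "real_mat A \<in> carrier_mat n n" "\<And>i j. i < n \<Longrightarrow> j < n \<Longrightarrow> 0 \<le> real_mat A $$ (i, j)"
      using A A_nonneg by auto
    define e where "e = real_vec deterministic_costs"
    have e: "e \<in> carrier_vec n" "\<And>i. i < n \<Longrightarrow>
        e $ i = real_of_int common_denominator * min (real_vec C $ i) (item_cost (real_vec c) (real_mat A) i)"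
      unfolding e_def by (simp add: deterministic_costs_def) (rule real_deterministic_costs)
    have D_pos: "0 < real_of_int common_denominator"
      using common_denominator_ge_1 by simp
    \<comment> \<open>Required for a legal instance of the solver, which is specified for
      nonnegative costs only.\<close>
    have "0 \<le> deterministic_costs $ i" if "i < n" for i
    proof -
      have "0 \<le> item_cost (real_vec c) (real_mat A) i"
        unfolding item_cost_def using nonneg_vec_index[OF rc(2) that] rA that
        by (intro add_nonneg_nonneg sum_nonneg) auto
      then have "0 \<le> e $ i"
        using e(2)[OF that] D_pos nonneg_vec_index[OF rC(2) that] by simp
      then show ?thesis
        using that by (simp add: e_def deterministic_costs_def)
    qed
    then have "(d, deterministic_costs) \<in> deterministic_instances D H"
      using d by (simp add: deterministic_instances_def deterministic_costs_def less_eq_vec_def flip: n_def)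
    from solver[OF this] obtain t \<tau> r where
      run: "exec p (init_state (enc_deterministic (d, deterministic_costs))) t \<tau>"
      and time: "t \<le> poly q (input_size (enc_deterministic (d, deterministic_costs)))"
      and out: "holds_output \<tau> (enc_answer enc_vec r)"
      and r: "solves (binary_solutions (H d) (g d)) (\<lambda>x. e \<bullet> x) (map_option real_vec r)"
      unfolding e_def by blast
    \<comment> \<open>The solver may output any rationals a priori; that they are 0 or 1, on which
      \<open>unpack\<close> relies, comes from feasibility of the answer.\<close>
    have r_binary: "z \<in> carrier_vec n \<and> (\<forall>k<n. z $ k \<in> {0, 1})" if "r = Some z" for z
    proof -
      have "real_vec z \<in> binary_vecs n"
        using r that by (simp add: solves_def binary_solutions_def n_def)
      then show ?thesis
        by (auto simp: binary_vecs_def)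
    qed
    obtain t' \<omega> where run': "exec (two_stage_program p) (init_state input) t' \<omega>"
      and time': "t' \<le> 2 + time_bound (input_size input) prepare + t + time_bound (input_size input) unpack"
      and out': "holds_output \<omega> (enc_answer (\<lambda>(x, y). enc_vec x @ enc_vec y) (map_option split_rat_vec r))"
      using exec_two_stage_program[OF run out r_binary] by blast
    \<comment> \<open>Polynomials with natural coefficients are monotone, so the size bound may be
      inserted into \<open>q\<close>.\<close>
    have "t \<le> poly q (input_size input + 2 + 2 * (input_size input * word_length (input_size input)))"
      using time poly_nat_mono[OF input_size_deterministic_costs] by (rule order_trans)
    with time' have "t' \<le> poly Q (input_size input)"
      unfolding Q[symmetric] by linarith
    moreover have "map_option (map_prod real_vec real_vec) (map_option split_rat_vec r)
        = map_option (split_vec (real_vec C) (real_vec c) (real_mat A)) (map_option real_vec r)"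
      using r_binary real_split_rat_vec by (cases r) auto
    then have "solves_within (sqrt (real (dim_col (H d)))) (two_stage_feasible (H d) (g d))
        (two_stage_cost (real_vec C) (real_vec c) (real_mat A))
        (map_option (map_prod real_vec real_vec) (map_option split_rat_vec r))"
      using solves_within_split_vec[OF n_def[symmetric] _ rC rc rA e D_pos r] assms(2)[OF d]
      by (simp add: n_def)
    ultimately show ?thesis
      using run' out' by blast
  qed
  then show ?thesis
    unfolding poly_time_search_def by (intro exI[of _ "two_stage_program p"] exI[of _ Q]) auto
qed

end
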